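(* Let $\Omega\subset\mathbb{R}^n$ be a bounded open convex set with smooth boundary, and let $\Lambda\ge 0$. If problem $(N_\Lambda)$ admits a nonconstant continuous viscosity solution $u$ on $\overline\Omega$, then $$\Lambda\ \ge\ \Lambda_\infty(\Omega):=\frac{2}{\operatorname{diam}(\Omega)} .$$ Moreover, for $\Lambda=\frac{2}{\operatorname{diam}(\Omega)}$ problem $(N_\Lambda)$ admits a nonconstant Lipschitz continuous viscosity solution.
   Context: $\operatorname{diam}(\Omega)=\sup_{x,y\in\Omega}|x-y|$ is the Euclidean diameter. $\nu$ denotes the outer unit normal to $\partial\Omega$, and $\Delta_\infty u=\sum_{i,j=1}^n u_{x_i}u_{x_ix_j}u_{x_j}$. For $\Lambda\ge 0$, problem $(N_\Lambda)$ is $$\min\{|\nabla u|-\Lambda|u|,-\Delta_\infty u\}=0 \text{ in }\{u>0\}\cap\Omega,\quad \max\{\Lambda|u|-|\nabla u|,-\Delta_\infty u\}=0 \text{ in }\{u<0\}\cap\Omega,\quad -\Delta_\infty u=0 \text{ in }\{u=0\}\cap\Omega,\quad \tfrac{\partial u}{\partial\nu}=0 \text{ on }\partial\Omega,$$ understood in the viscosity sense as follows. For $s\in\mathbb{R}$, $\xi\in\mathbb{R}^n$, $X$ a symmetric $n\times n$ matrix, let $F(s,\xi,X)=\min\{|\xi|-\Lambda|s|,-\langle X\xi,\xi\rangle\}$, $G(s,\xi,X)=\max\{\Lambda|s|-|\xi|,-\langle X\xi,\xi\rangle\}$, $H(X)=-\langle X\xi,\xi\rangle$ (evaluated at the same $\xi$).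 For a function $u$ and point $x_0$, let $E$ denote $F$ if $u(x_0)>0$, $G$ if $u(x_0)<0$, $H$ if $u(x_0)=0$. An upper semicontinuous $u$ on $\overline\Omega$ is a viscosity subsolution if: for every $x_0\in\Omega$ and $\phi\in C^2(\Omega)$ with $\phi(x_0)=u(x_0)$ and $u(x)<\phi(x)$ for $x\neq x_0$, one has $E(\phi(x_0),\nabla\phi(x_0),\nabla^2\phi(x_0))\le 0$; and for every $x_0\in\partial\Omega$ and $\phi\in C^2(\overline\Omega)$ with the same touching property, $\min\{E(\phi(x_0),\nabla\phi(x_0),\nabla^2\phi(x_0)),\frac{\partial\phi}{\partial\nu}(x_0)\}\le 0$. A lower semicontinuous $u$ is a viscosity supersolution if the same holds with $u(x)>\phi(x)$ for $x\ne x_0$, with "$E\le 0$" replaced by "$E\ge 0$" at interior points and with $\max\{E(\phi(x_0),\nabla\phi(x_0),\nabla^2\phi(x_0)),\frac{\partial\phi}{\partial\nu}(x_0)\}\ge 0$ at boundary points. A continuous $u$ is a viscosity solution if it is both a sub- and a supersolution. *)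

theory Defs
  imports "HOL-Analysis.Analysis"
begin

coinductive smooth_fun :: "('a::euclidean_space \<Rightarrow> real) \<Rightarrow> bool" where
  "(\<forall>x. f differentiable (at x)) \<Longrightarrow>
   (\<forall>v. smooth_fun (\<lambda>x. frechet_derivative f (at x) v)) \<Longrightarrow> smooth_fun f"

definition grad :: "('a::euclidean_space \<Rightarrow> real) \<Rightarrow> 'a \<Rightarrow> 'a" where
  "grad f x = (\<Sum>b\<in>Basis. frechet_derivative f (at x) b *\<^sub>R b)"

text \<open>Omega has smooth boundary, described by a global smooth defining function rho:
  Omega = {rho < 0}, with nonvanishing gradient on the boundary.\<close>
definition smooth_defining_fun :: "'a::euclidean_space set \<Rightarrow> ('a \<Rightarrow> real) \<Rightarrow> bool" where
  "smooth_defining_fun \<Omega> \<rho> \<longleftrightarrow> smooth_fun \<rho> \<and> \<Omega> = {x. \<rho> x < 0} \<and>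
     (\<forall>x\<in>frontier \<Omega>. grad \<rho> x \<noteq> 0)"

definition outer_normal :: "('a::euclidean_space \<Rightarrow> real) \<Rightarrow> 'a \<Rightarrow> 'a" where
  "outer_normal \<rho> x = grad \<rho> x /\<^sub>R norm (grad \<rho> x)"

definition C2_on :: "'a::euclidean_space set \<Rightarrow> ('a \<Rightarrow> real) \<Rightarrow> ('a \<Rightarrow> 'a) \<Rightarrow> ('a \<Rightarrow> 'a \<Rightarrow> 'a) \<Rightarrow> bool" where
  "C2_on S \<phi> g H \<longleftrightarrow> open S \<and>
     (\<forall>x\<in>S. (\<phi> has_derivative (\<lambda>h. g x \<bullet> h)) (at x) \<and> (g has_derivative H x) (at x)) \<and>
     (\<forall>v. continuous_on S (\<lambda>x. H x v))"

text \<open>The operator E: F if s>0, G if s<0, H if s=0, with xi the gradient and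
  q = <X xi, xi>.\<close>
definition E_op :: "real \<Rightarrow> real \<Rightarrow> 'a::euclidean_space \<Rightarrow> real \<Rightarrow> real" where
  "E_op \<Lambda> s \<xi> q =
     (if s > 0 then min (norm \<xi> - \<Lambda> * \<bar>s\<bar>) (- q)
      else if s < 0 then max (\<Lambda> * \<bar>s\<bar> - norm \<xi>) (- q)
      else - q)"

definition visc_sub :: "'a::euclidean_space set \<Rightarrow> ('a \<Rightarrow> 'a) \<Rightarrow> real \<Rightarrow> ('a \<Rightarrow> real) \<Rightarrow> bool" where
  "visc_sub \<Omega> \<nu> \<Lambda> u \<longleftrightarrow>
     (\<forall>x0\<in>\<Omega>. \<forall>\<phi> g H. C2_on \<Omega> \<phi> g H \<and> \<phi> x0 = u x0 \<and> (\<forall>x\<in>\<Omega>. x \<noteq> x0 \<longrightarrow> u x < \<phi> x)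
        \<longrightarrow> E_op \<Lambda> (\<phi> x0) (g x0) (H x0 (g x0) \<bullet> g x0) \<le> 0) \<and>
     (\<forall>x0\<in>frontier \<Omega>. \<forall>\<phi> g H T. closure \<Omega> \<subseteq> T \<and> C2_on T \<phi> g H \<and> \<phi> x0 = u x0 \<and>
          (\<forall>x\<in>closure \<Omega>. x \<noteq> x0 \<longrightarrow> u x < \<phi> x)
        \<longrightarrow> min (E_op \<Lambda> (\<phi> x0) (g x0) (H x0 (g x0) \<bullet> g x0)) (g x0 \<bullet> \<nu> x0) \<le> 0)"

definition visc_super :: "'a::euclidean_space set \<Rightarrow> ('a \<Rightarrow> 'a) \<Rightarrow> real \<Rightarrow> ('a \<Rightarrow> real) \<Rightarrow> bool" where
  "visc_super \<Omega> \<nu> \<Lambda> u \<longleftrightarrow>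
     (\<forall>x0\<in>\<Omega>. \<forall>\<phi> g H. C2_on \<Omega> \<phi> g H \<and> \<phi> x0 = u x0 \<and> (\<forall>x\<in>\<Omega>. x \<noteq> x0 \<longrightarrow> u x > \<phi> x)
        \<longrightarrow> E_op \<Lambda> (\<phi> x0) (g x0) (H x0 (g x0) \<bullet> g x0) \<ge> 0) \<and>
     (\<forall>x0\<in>frontier \<Omega>. \<forall>\<phi> g H T. closure \<Omega> \<subseteq> T \<and> C2_on T \<phi> g H \<and> \<phi> x0 = u x0 \<and>
          (\<forall>x\<in>closure \<Omega>. x \<noteq> x0 \<longrightarrow> u x > \<phi> x)
        \<longrightarrow> max (E_op \<Lambda> (\<phi> x0) (g x0) (H x0 (g x0) \<bullet> g x0)) (g x0 \<bullet> \<nu> x0) \<ge> 0)"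

definition visc_solution :: "'a::euclidean_space set \<Rightarrow> ('a \<Rightarrow> 'a) \<Rightarrow> real \<Rightarrow> ('a \<Rightarrow> real) \<Rightarrow> bool" where
  "visc_solution \<Omega> \<nu> \<Lambda> u \<longleftrightarrow>
     continuous_on (closure \<Omega>) u \<and> visc_sub \<Omega> \<nu> \<Lambda> u \<and> visc_super \<Omega> \<nu> \<Lambda> u"

definition nonconstant_on :: "'a set \<Rightarrow> ('a \<Rightarrow> real) \<Rightarrow> bool" where
  "nonconstant_on S u \<longleftrightarrow> (\<exists>x\<in>S. \<exists>y\<in>S. u x \<noteq> u y)"

end

theory Submission
  imports Defs
begin

text \<open>
  \<^emph>\<open>Lower bound.\<close> If \<open>u \<le> M\<close> is a subsolution with \<open>M \<ge> 0\<close>, a concave perturbation of a cone of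
  slope larger than \<open>\<Lambda> M\<close> with vertex in \<open>\<Omega>\<close> cannot touch \<open>u\<close> from above away from the vertex;
  on the boundary, convexity makes its normal derivative positive. Hence
  \<open>u x \<le> u z + \<Lambda> M |x - z|\<close>. A nonconstant solution changes sign by the strong maximum
  principle, so its maximum and minimum points both have distance at least \<open>1/\<Lambda>\<close> to the nodal
  set; the segment joining them meets the nodal set and lies in the closure of \<open>\<Omega>\<close>, so its
  length is at least \<open>2/\<Lambda>\<close>.

  \<^emph>\<open>Existence.\<close> Let \<open>a, b\<close> realise the diameter \<open>2R\<close>, and let \<open>\<Lambda> = 1/R\<close>. Perron's method
  is applied to the subsolutions \<open>v\<close> away from \<open>a\<close> and \<open>b\<close> with \<open>R - |x - a| \<le> v \<le> R\<close> and
  \<open>v b = - R\<close>. By the cone estimate they are all 1-Lipschitz, so no comparison principle is needed: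
  their supremum is 1-Lipschitz and a subsolution, and it is a supersolution wherever a bump can
  be added. At the remaining points (\<open>a\<close>, \<open>b\<close>, and those where \<open>u = R\<close>), which lie on the
  boundary, the missing inequalities follow from the Lipschitz bound and extremality.
\<close>

subsection \<open>Twice continuously differentiable functions\<close>

lemma C2_on_subset: "C2_on T \<phi> g H \<Longrightarrow> S \<subseteq> T \<Longrightarrow> open S \<Longrightarrow> C2_on S \<phi> g H"
  unfolding C2_on_def using continuous_on_subset by blast

lemma C2_on_add:
  assumes "C2_on T \<phi> g H" "C2_on T \<psi> k J"
  shows "C2_on T (\<lambda>x. \<phi> x + \<psi> x) (\<lambda>x. g x + k x) (\<lambda>x h. H x h + J x h)"
  using assms unfolding C2_on_def
  by (auto intro!: derivative_eq_intros continuous_intros simp: inner_add_left)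

lemma C2_on_uminus:
  assumes "C2_on T \<phi> g H"
  shows "C2_on T (\<lambda>x. - \<phi> x) (\<lambda>x. - g x) (\<lambda>x h. - H x h)"
  using assms unfolding C2_on_def
  by (auto intro!: derivative_eq_intros continuous_intros)

lemma C2_on_affine: "C2_on UNIV (\<lambda>x. c + p \<bullet> (x - x0)) (\<lambda>x. p) (\<lambda>x h. 0)"
  unfolding C2_on_def by (auto intro!: derivative_eq_intros)

text \<open>\<open>C2_on\<close> does not record that Hessians are symmetric, so \<open>Q\<close>
  may be any linear map. The derivatives then involve its symmetric part, which has the same
  quadratic form.\<close>

lemma C2_on_quadratic:
  assumes "linear Q"
  shows "C2_on UNIV (\<lambda>x. Q (x - x0) \<bullet> (x - x0) / 2)
    (\<lambda>x. (1/2) *\<^sub>R (Q (x - x0) + adjoint Q (x - x0))) (\<lambda>x h. (1/2) *\<^sub>R (Q h + adjoint Q h))"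
proof -
  have Q: "bounded_linear Q" and Q': "bounded_linear (adjoint Q)"
    using assms adjoint_linear by (simp_all add: linear_linear)
  have adj: "Q h \<bullet> k = adjoint Q k \<bullet> h" for h k
    using adjoint_works[OF assms, of h k] by (simp add: inner_commute)
  have sub: "((\<lambda>x. x - x0) has_derivative (\<lambda>h. h)) (at x)" for x
    by (auto intro!: derivative_eq_intros)
  have dQ: "((\<lambda>x. Q (x - x0)) has_derivative Q) (at x)"
    and dQ': "((\<lambda>x. adjoint Q (x - x0)) has_derivative adjoint Q) (at x)" for x
    using bounded_linear.has_derivative[OF Q sub] bounded_linear.has_derivative[OF Q' sub] by simp_all
  have "((\<lambda>x. Q (x - x0) \<bullet> (x - x0) / 2) has_derivative
    (\<lambda>h. (Q (x - x0) \<bullet> h + Q h \<bullet> (x - x0)) / 2)) (at x)" for x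
    by (intro bounded_linear.has_derivative[OF bounded_linear_divide] has_derivative_inner dQ sub)
  moreover have "((\<lambda>x. (1/2) *\<^sub>R (Q (x - x0) + adjoint Q (x - x0))) has_derivative
    (\<lambda>h. (1/2) *\<^sub>R (Q h + adjoint Q h))) (at x)" for x
    by (intro has_derivative_scaleR_right has_derivative_add dQ dQ')
  moreover have "(\<lambda>h. (Q (x - x0) \<bullet> h + Q h \<bullet> (x - x0)) / 2)
    = (\<lambda>h. ((1/2) *\<^sub>R (Q (x - x0) + adjoint Q (x - x0))) \<bullet> h)" for x
    by (rule ext) (simp add: adj[of _ "x - x0"] inner_add_left)
  ultimately show ?thesis
    unfolding C2_on_def by (simp only:) simp
qed

text \<open>Profiles are functions of the squared distance, which is smooth at the centre too. The
  set \<open>W\<close> of admissible squared distances allows profiles such as the square root,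
  singular at 0.\<close>

lemma C2_on_radial:
  fixes z :: "'a::euclidean_space"
  assumes W: "open W"
    and d1: "\<And>s. s \<in> W \<Longrightarrow> (w has_field_derivative w1 s) (at s)"
    and d2: "\<And>s. s \<in> W \<Longrightarrow> (w1 has_field_derivative w2 s) (at s)"
    and c: "continuous_on W w2"
  shows "C2_on {x. (x - z) \<bullet> (x - z) \<in> W} (\<lambda>x. w ((x - z) \<bullet> (x - z)))
     (\<lambda>x. (2 * w1 ((x - z) \<bullet> (x - z))) *\<^sub>R (x - z))
     (\<lambda>x h. (2 * w1 ((x - z) \<bullet> (x - z))) *\<^sub>R h
          + (4 * w2 ((x - z) \<bullet> (x - z)) * ((x - z) \<bullet> h)) *\<^sub>R (x - z))"
proof -
  let ?s = "\<lambda>x. (x - z) \<bullet> (x - z)"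
  have ds: "(?s has_derivative (\<lambda>h. 2 * ((x - z) \<bullet> h))) (at x)" for x
    by (auto intro!: derivative_eq_intros simp: inner_commute)
  have o: "open {x. ?s x \<in> W}"
    using open_vimage[OF W, of ?s] by (simp add: vimage_def continuous_intros)
  have c1: "continuous_on W w1"
    using d2 by (intro continuous_at_imp_continuous_on) (blast intro: DERIV_isCont)
  have cs: "continuous_on {x. ?s x \<in> W} ?s"
    by (intro continuous_intros)
  have cc: "continuous_on {x. ?s x \<in> W} (\<lambda>x. w1 (?s x))" "continuous_on {x. ?s x \<in> W} (\<lambda>x. w2 (?s x))"
    by (rule continuous_on_compose2[OF c1 cs], auto, rule continuous_on_compose2[OF c cs], auto)
  have dd: "((\<lambda>x. w (?s x)) has_derivative (\<lambda>h. w1 (?s x) * (2 * ((x - z) \<bullet> h)))) (at x)"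
    "((\<lambda>x. w1 (?s x)) has_derivative (\<lambda>h. w2 (?s x) * (2 * ((x - z) \<bullet> h)))) (at x)"
    if "?s x \<in> W" for x
    using has_derivative_compose[OF ds d1[OF that, unfolded has_field_derivative_def]]
      has_derivative_compose[OF ds d2[OF that, unfolded has_field_derivative_def]]
    by simp_all
  show ?thesis
    unfolding C2_on_def
  proof (intro conjI ballI allI o)
    fix x assume "x \<in> {x. ?s x \<in> W}"
    then have x: "?s x \<in> W" by simp
    show "((\<lambda>x. w (?s x)) has_derivative (\<lambda>h. ((2 * w1 (?s x)) *\<^sub>R (x - z)) \<bullet> h)) (at x)"
      using dd(1)[OF x] by (simp add: algebra_simps)
    show "((\<lambda>x. (2 * w1 (?s x)) *\<^sub>R (x - z)) has_derivative (\<lambda>h. (2 * w1 (?s x)) *\<^sub>R h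
          + (4 * w2 (?s x) * ((x - z) \<bullet> h)) *\<^sub>R (x - z))) (at x)"
      by (rule derivative_eq_intros dd(2)[OF x] refl)+ (auto simp: algebra_simps)
  next
    fix v
    show "continuous_on {x. ?s x \<in> W} (\<lambda>x. (2 * w1 (?s x)) *\<^sub>R v
          + (4 * w2 (?s x) * ((x - z) \<bullet> v)) *\<^sub>R (x - z))"
      by (intro continuous_intros cc)
  qed
qed

text \<open>The profile is \<open>c * sqrt s - b * s\<close> on positive \<open>s\<close>, hence the
  removed vertex. A positive \<open>b\<close> bends the cone to be strictly concave along its rays;
  \<open>b = 0\<close> gives the pure cone.\<close>

lemma C2_on_cone:
  fixes z :: "'a::euclidean_space"
  shows "C2_on (- {z}) (\<lambda>x. c * norm (x - z) - b * (norm (x - z))\<^sup>2)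
    (\<lambda>x. (c / norm (x - z) - 2 * b) *\<^sub>R (x - z))
    (\<lambda>x h. (c / norm (x - z) - 2 * b) *\<^sub>R h
      - (c / norm (x - z) ^ 3 * ((x - z) \<bullet> h)) *\<^sub>R (x - z))"
proof -
  define w where "w s = c * sqrt s - b * s" for s
  define w1 where "w1 s = c / (2 * sqrt s) - b" for s
  define w2 where "w2 s = - c / (4 * sqrt s ^ 3)" for s
  have "(w has_field_derivative w1 s) (at s)" "(w1 has_field_derivative w2 s) (at s)" if "s > 0" for s
  proof -
    define q where "q = sqrt s"
    have q: "q > 0" "s = q * q" using that by (auto simp: q_def)
    have d: "(sqrt has_field_derivative 1 / (2 * q)) (at s)"
      using DERIV_real_sqrt[OF that] by (simp add: q_def divide_simps mult.commute)
    show "(w has_field_derivative w1 s) (at s)"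
      unfolding w_def[abs_def] w1_def
      by (rule derivative_eq_intros d refl)+ (simp add: q_def[symmetric])
    have "((\<lambda>s. c / (2 * sqrt s) - b) has_field_derivative
      (0 * (2 * sqrt s) - c * (2 * (1 / (2 * q)))) / ((2 * sqrt s) * (2 * sqrt s)) - 0) (at s)"
      using that by (intro DERIV_diff DERIV_divide DERIV_const DERIV_cmult d) auto
    moreover have "(0 * (2 * sqrt s) - c * (2 * (1 / (2 * q)))) / ((2 * sqrt s) * (2 * sqrt s)) - 0 = w2 s"
      using q by (simp add: w2_def q_def[symmetric] power3_eq_cube)
    ultimately show "(w1 has_field_derivative w2 s) (at s)"
      unfolding w1_def[abs_def] by simp
  qed
  moreover have "continuous_on {0<..} w2"
    unfolding w2_def[abs_def] by (auto intro!: continuous_intros)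
  ultimately have "C2_on {x. (x - z) \<bullet> (x - z) \<in> {0<..}} (\<lambda>x. w ((x - z) \<bullet> (x - z)))
     (\<lambda>x. (2 * w1 ((x - z) \<bullet> (x - z))) *\<^sub>R (x - z))
     (\<lambda>x h. (2 * w1 ((x - z) \<bullet> (x - z))) *\<^sub>R h
          + (4 * w2 ((x - z) \<bullet> (x - z)) * ((x - z) \<bullet> h)) *\<^sub>R (x - z))"
    by (intro C2_on_radial) auto
  moreover have "{x. (x - z) \<bullet> (x - z) \<in> {0<..}} = - {z}" by auto
  moreover have "w ((x - z) \<bullet> (x - z)) = c * norm (x - z) - b * (norm (x - z))\<^sup>2"
    "2 * w1 ((x - z) \<bullet> (x - z)) = c / norm (x - z) - 2 * b"
    "4 * w2 ((x - z) \<bullet> (x - z)) * t = - (c / norm (x - z) ^ 3 * t)" for x t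
    by (simp_all add: w_def w1_def w2_def norm_eq_sqrt_inner)
  ultimately show ?thesis by (simp only: scaleR_minus_left diff_conv_add_uminus)
qed

section \<open>Continuity, Taylor expansion and second-order conditions at a minimum\<close>

lemma C2_on_linear: "C2_on T \<phi> g H \<Longrightarrow> x \<in> T \<Longrightarrow> linear (H x)"
  unfolding C2_on_def using has_derivative_bounded_linear bounded_linear.linear by blast

lemma C2_on_continuous:
  assumes "C2_on T \<phi> g H"
  shows "continuous_on T \<phi>" "continuous_on T g" "continuous_on T (\<lambda>x. H x (g x) \<bullet> g x)"
proof -
  show "continuous_on T \<phi>" and g: "continuous_on T g"
    using assms unfolding C2_on_def
    by (blast intro: has_derivative_continuous continuous_at_imp_continuous_on)+
  \<comment> \<open>\<open>C2_on\<close> gives continuity of \<open>H x v\<close> for a fixed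
    direction \<open>v\<close> only; the moving direction \<open>g x\<close> is therefore expanded
    in the basis.\<close>
  have "H x (g x) = (\<Sum>b\<in>Basis. (g x \<bullet> b) *\<^sub>R H x b)" if "x \<in> T" for x
  proof -
    have "H x (\<Sum>b\<in>Basis. (g x \<bullet> b) *\<^sub>R b) = (\<Sum>b\<in>Basis. (g x \<bullet> b) *\<^sub>R H x b)"
      using C2_on_linear[OF assms that] by (simp add: linear_sum linear_scale)
    then show ?thesis by (simp add: euclidean_representation)
  qed
  moreover have "continuous_on T (\<lambda>x. (\<Sum>b\<in>Basis. (g x \<bullet> b) *\<^sub>R H x b) \<bullet> g x)"
    using assms unfolding C2_on_def by (intro continuous_intros g) auto
  ultimately show "continuous_on T (\<lambda>x. H x (g x) \<bullet> g x)"
    by (subst continuous_on_cong[OF refl]) auto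
qed

text \<open>The mean value theorem is applied along the segment to \<phi> minus its quadratic
  polynomial. The derivative of this difference is the first-order remainder of \<open>g\<close> at
  \<open>x0\<close>, so neither third derivatives nor symmetry of the Hessian are involved.\<close>

lemma C2_on_Taylor:
  fixes \<phi> :: "'a::euclidean_space \<Rightarrow> real"
  assumes "C2_on T \<phi> g H" "x0 \<in> T" "\<eta> > 0"
  obtains r where "r > 0"
    "\<And>x. norm (x - x0) < r \<Longrightarrow>
      \<bar>\<phi> x - \<phi> x0 - g x0 \<bullet> (x - x0) - H x0 (x - x0) \<bullet> (x - x0) / 2\<bar> \<le> \<eta> * (norm (x - x0))\<^sup>2"
proof -
  have T: "open T" and dg: "(g has_derivative H x0) (at x0)"
    and df: "\<And>x. x \<in> T \<Longrightarrow> (\<phi> has_derivative (\<lambda>h. g x \<bullet> h)) (at x)"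
    using assms unfolding C2_on_def by auto
  obtain r1 where r1: "r1 > 0" "ball x0 r1 \<subseteq> T"
    using T assms(2) open_contains_ball by blast
  obtain r2 where r2: "r2 > 0"
    "\<And>y. norm (y - x0) < r2 \<Longrightarrow> norm (g y - g x0 - H x0 (y - x0)) \<le> \<eta> * norm (y - x0)"
    using dg assms(3) unfolding has_derivative_at_alt by metis
  have "\<bar>\<phi> x - \<phi> x0 - g x0 \<bullet> (x - x0) - H x0 (x - x0) \<bullet> (x - x0) / 2\<bar> \<le> \<eta> * (norm (x - x0))\<^sup>2"
    if x: "norm (x - x0) < min r1 r2" for x
  proof -
    define h where "h = x - x0"
    define f where "f t = \<phi> (x0 + t *\<^sub>R h) - t * (g x0 \<bullet> h) - t\<^sup>2 * (H x0 h \<bullet> h) / 2" for t :: real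
    define f' where "f' t = (g (x0 + t *\<^sub>R h) - g x0 - H x0 (t *\<^sub>R h)) \<bullet> h" for t :: real
    have lin: "linear (H x0)" using C2_on_linear assms(1,2) by blast
    have small: "norm (t *\<^sub>R h) < min r1 r2" if "0 \<le> t" "t \<le> 1" for t
      using x that mult_left_le_one_le[of "norm h" t] by (simp add: h_def)
    have f': "(f has_field_derivative f' t) (at t)" if "0 \<le> t" "t \<le> 1" for t
    proof -
      have "x0 + t *\<^sub>R h \<in> T" using r1 small[OF that] by (auto simp: subset_iff dist_norm)
      then have "((\<lambda>t. \<phi> (x0 + t *\<^sub>R h)) has_derivative (\<lambda>d. g (x0 + t *\<^sub>R h) \<bullet> (d *\<^sub>R h))) (at t)"
        by (intro has_derivative_compose[OF _ df]) (auto intro!: derivative_eq_intros)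
      then have "((\<lambda>t. \<phi> (x0 + t *\<^sub>R h)) has_field_derivative (g (x0 + t *\<^sub>R h) \<bullet> h)) (at t)"
        by (rule has_derivative_imp_has_field_derivative) simp
      then show ?thesis
        unfolding f_def f'_def
        by (auto intro!: derivative_eq_intros
            simp: linear_scale[OF lin] inner_diff_left power2_eq_square)
    qed
    obtain t where t: "0 < t" "t < 1" "f 1 - f 0 = f' t"
      using MVT2[of 0 1 f f'] f' by auto
    have "\<bar>f' t\<bar> \<le> norm (g (x0 + t *\<^sub>R h) - g x0 - H x0 (t *\<^sub>R h)) * norm h"
      unfolding f'_def by (rule Cauchy_Schwarz_ineq2)
    also have "\<dots> \<le> (\<eta> * norm (t *\<^sub>R h)) * norm h"
      using r2(2)[of "x0 + t *\<^sub>R h"] small[of t] t by (intro mult_right_mono) auto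
    also have "\<dots> \<le> (\<eta> * norm h) * norm h"
      using t assms(3) by (intro mult_right_mono mult_left_mono) (auto intro: mult_left_le_one_le)
    finally have "\<bar>f 1 - f 0\<bar> \<le> \<eta> * (norm h)\<^sup>2"
      using t by (simp add: power2_eq_square mult.assoc)
    then show ?thesis
      unfolding f_def h_def by (simp add: algebra_simps)
  qed
  then show ?thesis
    using that[of "min r1 r2"] r1 r2 by auto
qed

lemma le_of_perturbation:
  fixes A B C :: real
  assumes "\<And>\<eta>. \<eta> > 0 \<Longrightarrow> A \<le> C + \<eta> * B"
  shows "A \<le> C"
proof (rule tendsto_lowerbound)
  have "((\<lambda>\<eta>. C + \<eta> * B) \<longlongrightarrow> C + 0 * B) (at_right 0)"
    by (intro tendsto_intros)
  then show "((\<lambda>\<eta>. C + \<eta> * B) \<longlongrightarrow> C) (at_right 0)" by simp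
  show "\<forall>\<^sub>F \<eta> in at_right 0. A \<le> C + \<eta> * B"
    using eventually_at_right_less[of "0::real"] assms by (auto elim: eventually_mono)
qed simp

lemma C2_on_minimum:
  fixes f :: "'a::euclidean_space \<Rightarrow> real"
  assumes f: "C2_on T f g H" and x: "x \<in> T" and S: "open S" "x \<in> S"
    and min: "\<And>y. y \<in> S \<Longrightarrow> f x \<le> f y"
  shows "g x = 0" "0 \<le> H x h \<bullet> h"
proof -
  have "(f has_derivative (\<lambda>h. g x \<bullet> h)) (at x)"
    using f x unfolding C2_on_def by blast
  then have "(\<lambda>h. g x \<bullet> h) = (\<lambda>h. 0)"
    using differential_zero_maxmin[of x S f] S min by blast
  then show g: "g x = 0"
    by (metis inner_eq_zero_iff)
  have lin: "linear (H x)" using C2_on_linear f x by blast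
  have "0 \<le> H x h \<bullet> h / 2 + \<eta> * (norm h)\<^sup>2" if \<eta>: "\<eta> > 0" for \<eta>
  proof -
    obtain r where r: "r > 0" "\<And>y. norm (y - x) < r \<Longrightarrow>
      \<bar>f y - f x - g x \<bullet> (y - x) - H x (y - x) \<bullet> (y - x) / 2\<bar> \<le> \<eta> * (norm (y - x))\<^sup>2"
      using C2_on_Taylor[OF f x \<eta>] by metis
    have "((\<lambda>t. x + t *\<^sub>R h) \<longlongrightarrow> x + 0 *\<^sub>R h) (at_right 0)"
      by (intro tendsto_intros)
    then have "\<forall>\<^sub>F t in at_right 0. x + t *\<^sub>R h \<in> S \<inter> ball x r"
      using S r(1) by (intro topological_tendstoD) auto
    then have "\<forall>\<^sub>F t in at_right (0::real). x + t *\<^sub>R h \<in> S \<inter> ball x r \<and> t > 0"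
      by (intro eventually_conj eventually_at_right_less)
    then obtain t :: real where t: "t > 0" "x + t *\<^sub>R h \<in> S" "x + t *\<^sub>R h \<in> ball x r"
      using eventually_happens[of _ "at_right (0::real)"] by auto
    then have "\<bar>f (x + t *\<^sub>R h) - f x - H x (t *\<^sub>R h) \<bullet> (t *\<^sub>R h) / 2\<bar> \<le> \<eta> * (norm (t *\<^sub>R h))\<^sup>2"
      using r(2)[of "x + t *\<^sub>R h"] by (simp add: dist_norm g)
    \<comment> \<open>Dividing the expansion by the square of \<open>t\<close> leaves the
      second-order term with an error proportional to \<eta>, which is then sent to 0.\<close>
    then have "0 \<le> t\<^sup>2 * (H x h \<bullet> h / 2 + \<eta> * (norm h)\<^sup>2)"
      using min[OF t(2)] by (simp add: linear_scale[OF lin] power2_eq_square algebra_simps)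
    then show ?thesis using t(1) by (simp add: zero_le_mult_iff)
  qed
  then show "0 \<le> H x h \<bullet> h"
    using le_of_perturbation[of "- (H x h \<bullet> h / 2)" 0 "(norm h)\<^sup>2"] by fastforce
qed

subsection \<open>The operator and the domain\<close>

lemma E_op_uminus: "E_op \<Lambda> (- s) (- p) (- q) = - E_op \<Lambda> s p q"
  unfolding E_op_def by (auto simp: min_def max_def)

lemma E_op_antimono: "q \<le> q' \<Longrightarrow> E_op \<Lambda> s p q' \<le> E_op \<Lambda> s p q"
  unfolding E_op_def by auto

text \<open>\<open>q\<close> enters only as \<open>- q\<close> inside a minimum or maximum, so
  raising it by \<open>e\<close> lowers the operator by at most \<open>e\<close>. This removes the
  small quadratic terms added to test functions.\<close>

lemma E_op_perturb: "0 \<le> e \<Longrightarrow> E_op \<Lambda> s p q \<le> E_op \<Lambda> s p (q + e) + e"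
  unfolding E_op_def by auto

text \<open>The hypothesis on \<open>p\<close> and \<open>q\<close> always holds for \<open>q = \<langle>X p, p\<rangle>\<close>; it makes positivity
  of the operator an open condition across the discontinuity at \<open>s = 0\<close>.\<close>

lemma E_op_pos_iff:
  assumes "\<Lambda> \<ge> 0" "p = 0 \<Longrightarrow> q = 0"
  shows "E_op \<Lambda> s p q > 0 \<longleftrightarrow> (q < 0 \<and> \<Lambda> * s < norm p) \<or> norm p < - \<Lambda> * s"
proof (cases s "0::real" rule: linorder_cases)
  case less
  then have "\<Lambda> * s \<le> 0" using assms(1) by (simp add: mult_nonneg_nonpos)
  moreover have "norm p > 0" if "q < 0" using assms(2) that by auto
  ultimately show ?thesis
    using less by (auto simp: E_op_def less_max_iff_disj simp del: zero_less_norm_iff)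
next
  case equal
  then show ?thesis using assms(2) by (auto simp: E_op_def)
next
  case greater
  then have "0 \<le> \<Lambda> * s" using assms(1) by simp
  then have "\<not> norm p < - (\<Lambda> * s)" using norm_ge_zero[of p] by linarith
  then show ?thesis using greater by (auto simp: E_op_def)
qed

lemma compact_gap:
  fixes f :: "'a::topological_space \<Rightarrow> real"
  assumes "compact K" "continuous_on K f" "\<And>x. x \<in> K \<Longrightarrow> f x > 0"
  obtains d where "d > 0" "\<And>x. x \<in> K \<Longrightarrow> d \<le> f x"
proof (cases "K = {}")
  case True then show ?thesis using that[of 1] by auto
next
  case False
  then obtain y where "y \<in> K" "\<And>x. x \<in> K \<Longrightarrow> f y \<le> f x"
    using continuous_attains_inf[OF assms(1) _ assms(2)] by metis
  then show ?thesis using that[of "f y"] assms(3) by auto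
qed

section \<open>Boundary geometry of a smooth convex domain\<close>

locale smooth_convex_domain =
  fixes \<Omega> :: "'a::euclidean_space set" and \<rho> :: "'a \<Rightarrow> real"
  assumes open_\<Omega>: "open \<Omega>" and bounded_\<Omega>: "bounded \<Omega>" and convex_\<Omega>: "convex \<Omega>"
    and nonempty: "\<Omega> \<noteq> {}" and defining: "smooth_defining_fun \<Omega> \<rho>"
begin

lemma compact_closure: "compact (closure \<Omega>)"
  using bounded_\<Omega> by simp

lemma convex_closure': "convex (closure \<Omega>)"
  using convex_\<Omega> by (rule convex_closure)

lemma closure_cases: "x \<in> closure \<Omega> \<longleftrightarrow> x \<in> \<Omega> \<or> x \<in> frontier \<Omega>"
  using open_\<Omega> by (metis DiffI Diff_iff closure_Un_frontier UnE UnI1 UnI2 Un_iff)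

lemma frontier_disjoint: "x \<in> frontier \<Omega> \<Longrightarrow> x \<notin> \<Omega>"
  using open_\<Omega> by (simp add: frontier_def interior_open)

lemma has_derivative_\<rho>: "(\<rho> has_derivative (\<lambda>h. grad \<rho> x \<bullet> h)) (at x)"
proof -
  have "\<rho> differentiable (at x)"
    using defining unfolding smooth_defining_fun_def by (auto elim: smooth_fun.cases)
  then have d: "(\<rho> has_derivative frechet_derivative \<rho> (at x)) (at x)"
    by (simp add: frechet_derivative_works)
  then have lin: "linear (frechet_derivative \<rho> (at x))"
    using has_derivative_linear by blast
  have "frechet_derivative \<rho> (at x) h = grad \<rho> x \<bullet> h" for h
  proof -
    have "frechet_derivative \<rho> (at x) (\<Sum>b\<in>Basis. (h \<bullet> b) *\<^sub>R b) =
      (\<Sum>b\<in>Basis. (h \<bullet> b) * frechet_derivative \<rho> (at x) b)"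
      using lin by (simp add: linear_sum linear_scale)
    moreover have "(\<Sum>b\<in>Basis. (h \<bullet> b) * frechet_derivative \<rho> (at x) b) = grad \<rho> x \<bullet> h"
      unfolding grad_def inner_sum_left by (simp add: inner_commute mult.commute)
    ultimately show ?thesis
      by (simp add: euclidean_representation)
  qed
  then have "frechet_derivative \<rho> (at x) = (\<lambda>h. grad \<rho> x \<bullet> h)" by auto
  then show ?thesis using d by simp
qed

lemma continuous_on_grad: "continuous_on S (grad \<rho>)"
proof -
  have "smooth_fun \<rho>" using defining unfolding smooth_defining_fun_def by blast
  then have "smooth_fun (\<lambda>x. frechet_derivative \<rho> (at x) v)" for v
    by (auto elim: smooth_fun.cases)
  then have "(\<lambda>x. frechet_derivative \<rho> (at x) v) differentiable (at x)" for v x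
    by (auto elim: smooth_fun.cases)
  then have "continuous_on S (\<lambda>x. frechet_derivative \<rho> (at x) v)" for v
    by (intro continuous_at_imp_continuous_on) (blast intro: differentiable_imp_continuous_within)
  then show ?thesis
    unfolding grad_def[abs_def] by (intro continuous_intros)
qed

lemma \<rho>_frontier:
  assumes "x \<in> frontier \<Omega>"
  shows "\<rho> x = 0"
proof -
  have eq: "\<Omega> = {x. \<rho> x < 0}" using defining unfolding smooth_defining_fun_def by blast
  have "continuous_on UNIV \<rho>"
    using has_derivative_\<rho> by (intro continuous_at_imp_continuous_on) (blast intro: has_derivative_continuous)
  then have "closed {x. \<rho> x \<le> 0}"
    by (intro closed_Collect_le continuous_intros)
  then have "closure \<Omega> \<subseteq> {x. \<rho> x \<le> 0}"
    using eq by (intro closure_minimal) auto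
  then have "\<rho> x \<le> 0" using assms by (auto simp: frontier_def)
  moreover have "\<not> \<rho> x < 0" using frontier_disjoint[OF assms] eq by blast
  ultimately show ?thesis by simp
qed

lemma \<rho>_directional:
  "((\<lambda>t. (\<rho> (x + t *\<^sub>R h) - \<rho> x) / t) \<longlongrightarrow> grad \<rho> x \<bullet> h) (at_right 0)"
proof -
  have "((\<lambda>t. \<rho> (x + t *\<^sub>R h)) has_derivative (\<lambda>d. grad \<rho> (x + 0 *\<^sub>R h) \<bullet> (d *\<^sub>R h))) (at 0)"
    by (intro has_derivative_compose[OF _ has_derivative_\<rho>]) (auto intro!: derivative_eq_intros)
  then have "((\<lambda>t. \<rho> (x + t *\<^sub>R h)) has_field_derivative (grad \<rho> x \<bullet> h)) (at 0)"
    by (intro has_derivative_imp_has_field_derivative) auto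
  then have "((\<lambda>t. (\<rho> (x + t *\<^sub>R h) - \<rho> x) / t) \<longlongrightarrow> grad \<rho> x \<bullet> h) (at 0)"
    unfolding has_field_derivative_iff by simp
  then show ?thesis by (rule tendsto_mono[rotated]) (simp add: at_le)
qed

lemma eventually_inward:
  assumes "x \<in> frontier \<Omega>" "grad \<rho> x \<bullet> h < 0"
  shows "\<forall>\<^sub>F t in at_right 0. x + t *\<^sub>R h \<in> \<Omega>"
proof -
  have eq: "\<Omega> = {x. \<rho> x < 0}" using defining unfolding smooth_defining_fun_def by blast
  have "\<forall>\<^sub>F t in at_right 0. (\<rho> (x + t *\<^sub>R h) - \<rho> x) / t < 0"
    using order_tendstoD(2)[OF \<rho>_directional assms(2)] .
  then show ?thesis
    using eventually_at_right_less[of "0::real"]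
    by eventually_elim (auto simp: eq \<rho>_frontier[OF assms(1)] divide_less_0_iff)
qed

text \<open>Segments from \<open>x\<close> to points of \<Omega> stay in \<Omega> by convexity, so
  \<rho> cannot increase along them at \<open>x\<close>; this gives the weak inequality. It becomes
  strict because \<open>z\<close> is interior and can be moved a little along the gradient.\<close>

lemma grad_inward:
  assumes x: "x \<in> frontier \<Omega>" and z: "z \<in> \<Omega>"
  shows "grad \<rho> x \<bullet> (x - z) > 0"
proof -
  have eq: "\<Omega> = {x. \<rho> x < 0}" and ne: "grad \<rho> x \<noteq> 0"
    using defining x unfolding smooth_defining_fun_def by blast+
  have le: "grad \<rho> x \<bullet> (y - x) \<le> 0" if y: "y \<in> \<Omega>" for y
  proof (rule tendsto_upperbound[OF \<rho>_directional])
    have "\<forall>\<^sub>F t in at_right 0. t < (1::real)"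
      by (rule eventually_at_rightI[of 0 1]) auto
    then show "\<forall>\<^sub>F t in at_right 0. (\<rho> (x + t *\<^sub>R (y - x)) - \<rho> x) / t \<le> 0"
      using eventually_at_right_less[of "0::real"]
    proof eventually_elim
      case (elim t)
      have "x \<in> closure \<Omega>" "y \<in> interior \<Omega>"
        using x y open_\<Omega> by (auto simp: frontier_def interior_open)
      then have "x - t *\<^sub>R (x - y) \<in> interior \<Omega>"
        using elim convex_\<Omega> mem_interior_closure_convex_shrink by fastforce
      then have "\<rho> (x + t *\<^sub>R (y - x)) < 0"
        using interior_subset by (auto simp: eq algebra_simps)
      then show ?case using elim by (simp add: \<rho>_frontier[OF x] divide_nonpos_pos)
    qed
  qed simp
  have "((\<lambda>t. z + t *\<^sub>R grad \<rho> x) \<longlongrightarrow> z + 0 *\<^sub>R grad \<rho> x) (at_right (0::real))"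
    by (intro tendsto_intros)
  then have "\<forall>\<^sub>F t in at_right (0::real). z + t *\<^sub>R grad \<rho> x \<in> \<Omega>"
    using open_\<Omega> z by (intro topological_tendstoD) auto
  then have "\<forall>\<^sub>F t in at_right (0::real). z + t *\<^sub>R grad \<rho> x \<in> \<Omega> \<and> t > 0"
    by (intro eventually_conj eventually_at_right_less)
  then obtain t :: real where "t > 0" "z + t *\<^sub>R grad \<rho> x \<in> \<Omega>"
    using eventually_happens[of _ "at_right (0::real)"] by auto
  moreover from this ne have "t * (grad \<rho> x \<bullet> grad \<rho> x) > 0" by simp
  ultimately show ?thesis
    using le[of "z + t *\<^sub>R grad \<rho> x"] by (simp add: inner_diff_right inner_add_right)
qed

text \<open>Only the sign of the normal derivative matters, so the unnormalised gradient replaces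
  the normal in the pointwise conditions below.\<close>

lemma inner_outer_normal_sign:
  "p \<bullet> outer_normal \<rho> x \<le> 0 \<longleftrightarrow> p \<bullet> grad \<rho> x \<le> 0"
  unfolding outer_normal_def
  by (cases "grad \<rho> x = 0") (auto simp: divide_inverse[symmetric] mult_le_0_iff)

subsection \<open>Pointwise subsolutions\<close>

text \<open>The arguments \<open>s\<close>, \<open>p\<close>, \<open>q\<close> stand for the value,
  the gradient and the Hessian form along the gradient. At boundary points the disjunction encodes
  that the minimum of operator and normal derivative is nonpositive.\<close>

definition sub_cond :: "real \<Rightarrow> 'a \<Rightarrow> real \<Rightarrow> 'a \<Rightarrow> real \<Rightarrow> bool" where
  "sub_cond \<Lambda> x s p q \<longleftrightarrow> E_op \<Lambda> s p q \<le> 0 \<or> (x \<in> frontier \<Omega> \<and> p \<bullet> grad \<rho> x \<le> 0)"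

text \<open>The condition is stated pointwise because the Perron family below may violate it at two
  points. Test functions are global at interior and boundary points alike, so both kinds are handled
  together.\<close>

definition sub_at :: "real \<Rightarrow> ('a \<Rightarrow> real) \<Rightarrow> 'a \<Rightarrow> bool" where
  "sub_at \<Lambda> v x0 \<longleftrightarrow> (\<forall>\<phi> g H. C2_on UNIV \<phi> g H \<and> \<phi> x0 = v x0 \<and>
     (\<forall>x\<in>closure \<Omega>. x \<noteq> x0 \<longrightarrow> v x < \<phi> x) \<longrightarrow> sub_cond \<Lambda> x0 (v x0) (g x0) (H x0 (g x0) \<bullet> g x0))"

text \<open>A function that is touched locally and not necessarily strictly is compared with the
  second-order Taylor polynomial of the test function, made global and strict by a small
  quadratic and a large quartic term.\<close>

lemma sub_at_local_test:
  assumes sub: "sub_at \<Lambda> v x0" and v: "continuous_on (closure \<Omega>) v"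
    and \<phi>: "C2_on T \<phi> g H" "x0 \<in> T" and e: "e > 0"
    and touch: "\<And>x. x \<in> closure \<Omega> \<Longrightarrow> dist x x0 < e \<Longrightarrow> v x - v x0 \<le> \<phi> x - \<phi> x0"
  shows "sub_cond \<Lambda> x0 (v x0) (g x0) (H x0 (g x0) \<bullet> g x0)"
proof -
  define p where "p = g x0"
  define Q where "Q = H x0"
  have lin: "linear Q" unfolding Q_def using \<phi> by (rule C2_on_linear)
  then have lin': "linear (adjoint Q)" by (rule adjoint_linear)
  have Q0: "Q 0 = 0" "adjoint Q 0 = 0" using lin lin' linear_0 by blast+
  have adj: "adjoint Q p \<bullet> p = Q p \<bullet> p"
    using adjoint_works[OF lin, of p p] by (simp add: inner_commute)
  \<comment> \<open>The extra term comes from the Hessian of \<open>2 * \<eta>\<close> times the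
    squared distance. One \<eta> pays for the Taylor error, the other makes the touching
    strict.\<close>
  have pert: "sub_cond \<Lambda> x0 (v x0) p (Q p \<bullet> p + 4 * \<eta> * (norm p)\<^sup>2)" if \<eta>: "\<eta> > 0" for \<eta>
  proof -
    obtain r where r: "r > 0" "\<And>x. norm (x - x0) < r \<Longrightarrow>
      \<bar>\<phi> x - \<phi> x0 - p \<bullet> (x - x0) - Q (x - x0) \<bullet> (x - x0) / 2\<bar> \<le> \<eta> * (norm (x - x0))\<^sup>2"
      using C2_on_Taylor[OF \<phi> \<eta>] unfolding p_def Q_def by metis
    define r' where "r' = min r e"
    have r': "r' > 0" using r e by (simp add: r'_def)
    define k where "k x = v x - v x0 - p \<bullet> (x - x0) - Q (x - x0) \<bullet> (x - x0) / 2" for x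
    have "continuous_on (closure \<Omega>) k"
      unfolding k_def using lin
      by (intro continuous_intros v linear_continuous_on_compose[of _ "\<lambda>x. x - x0"]) auto
    then have "compact (k ` closure \<Omega>)" using compact_closure compact_continuous_image by blast
    then obtain B where B: "B > 0" "\<And>x. x \<in> closure \<Omega> \<Longrightarrow> \<bar>k x\<bar> \<le> B"
      using compact_imp_bounded[of "k ` closure \<Omega>"] unfolding bounded_pos by auto
    \<comment> \<open>With this constant the quartic term is at least the bound \<open>B\<close> on
      \<open>k\<close> outside the ball of radius \<open>r'\<close>, where nothing is known about
      \<phi>.\<close>
    define K where "K = B / r' ^ 4"
    have K: "K > 0" using B r' by (simp add: K_def)
    define \<psi> where "\<psi> x = (v x0 + p \<bullet> (x - x0)) + (Q (x - x0) \<bullet> (x - x0) / 2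
      + (2 * \<eta> * ((x - x0) \<bullet> (x - x0)) + K * ((x - x0) \<bullet> (x - x0))\<^sup>2))" for x
    define w1 where "w1 s = 2 * \<eta> + 2 * K * s" for s :: real
    have rad: "C2_on UNIV (\<lambda>x. 2 * \<eta> * ((x - x0) \<bullet> (x - x0)) + K * ((x - x0) \<bullet> (x - x0))\<^sup>2)
      (\<lambda>x. (2 * w1 ((x - x0) \<bullet> (x - x0))) *\<^sub>R (x - x0))
      (\<lambda>x h. (2 * w1 ((x - x0) \<bullet> (x - x0))) *\<^sub>R h + (4 * (2 * K) * ((x - x0) \<bullet> h)) *\<^sub>R (x - x0))"
    proof -
      have "((\<lambda>s. 2 * \<eta> * s + K * s\<^sup>2) has_field_derivative w1 s) (at s)"
        "(w1 has_field_derivative 2 * K) (at s)" for s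
        unfolding w1_def[abs_def] by (auto intro!: derivative_eq_intros)
      then show ?thesis
        using C2_on_radial[of UNIV "\<lambda>s. 2 * \<eta> * s + K * s\<^sup>2" w1 "\<lambda>s. 2 * K" x0] by simp
    qed
    note C = C2_on_add[OF C2_on_affine[of "v x0" p x0] C2_on_add[OF C2_on_quadratic[OF lin, of x0] rad]]
    have strict: "v x < \<psi> x" if x: "x \<in> closure \<Omega>" "x \<noteq> x0" for x
    proof (cases "norm (x - x0) < r'")
      case True
      then have "v x - v x0 \<le> \<phi> x - \<phi> x0"
        using touch[OF x(1)] by (simp add: r'_def dist_norm)
      moreover have "\<phi> x - \<phi> x0 \<le> p \<bullet> (x - x0) + Q (x - x0) \<bullet> (x - x0) / 2 + \<eta> * (norm (x - x0))\<^sup>2"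
        using r(2)[of x] True by (simp add: r'_def abs_le_iff)
      moreover have "0 < \<eta> * (norm (x - x0))\<^sup>2" "0 \<le> K * ((x - x0) \<bullet> (x - x0))\<^sup>2"
        using \<eta> x K by auto
      ultimately show ?thesis
        unfolding \<psi>_def by (simp add: power2_norm_eq_inner)
    next
      case False
      then have "r' ^ 4 \<le> norm (x - x0) ^ 4" using r' by (intro power_mono) auto
      then have "B \<le> K * norm (x - x0) ^ 4"
        using r' B by (simp add: K_def divide_simps mult.commute)
      also have "norm (x - x0) ^ 4 = ((norm (x - x0))\<^sup>2)\<^sup>2" by simp
      also have "\<dots> = ((x - x0) \<bullet> (x - x0))\<^sup>2" by (simp only: power2_norm_eq_inner)
      finally have "k x \<le> K * ((x - x0) \<bullet> (x - x0))\<^sup>2" using B(2)[OF x(1)] by auto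
      moreover have "0 < \<eta> * ((x - x0) \<bullet> (x - x0))" using \<eta> x by simp
      ultimately show ?thesis unfolding \<psi>_def k_def by simp
    qed
    have at: "sub_cond \<Lambda> x0 (v x0) (G x0) (J x0 (G x0) \<bullet> G x0)" if "C2_on UNIV \<psi> G J" for G J
    proof -
      have "\<psi> x0 = v x0" by (simp add: \<psi>_def Q0)
      then show ?thesis using sub that strict unfolding sub_at_def by blast
    qed
    have "sub_cond \<Lambda> x0 (v x0) p (((1/2) *\<^sub>R (Q p + adjoint Q p) + (4 * \<eta>) *\<^sub>R p) \<bullet> p)"
      using at[OF C[folded \<psi>_def]] by (simp add: Q0 w1_def)
    then show ?thesis
      by (simp add: inner_add_left adj power2_norm_eq_inner)
  qed
  show ?thesis
  proof (cases "x0 \<in> frontier \<Omega> \<and> p \<bullet> grad \<rho> x0 \<le> 0")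
    case True then show ?thesis by (simp add: sub_cond_def p_def)
  next
    case False
    have "E_op \<Lambda> (v x0) p (Q p \<bullet> p) \<le> 0"
    proof (rule le_of_perturbation)
      fix \<eta> :: real assume "\<eta> > 0"
      then have "E_op \<Lambda> (v x0) p (Q p \<bullet> p + 4 * \<eta> * (norm p)\<^sup>2) \<le> 0"
        using pert False by (auto simp: sub_cond_def)
      then show "E_op \<Lambda> (v x0) p (Q p \<bullet> p) \<le> 0 + \<eta> * (4 * (norm p)\<^sup>2)"
        using E_op_perturb[of "4 * \<eta> * (norm p)\<^sup>2" \<Lambda> "v x0" p "Q p \<bullet> p"] \<open>\<eta> > 0\<close> by simp
    qed
    then show ?thesis by (simp add: sub_cond_def p_def Q_def)
  qed
qed

text \<open>From left to right, global test functions restrict to \<Omega>, or serve with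
  \<open>T = UNIV\<close> on the boundary. Conversely, a test function defined only on \<Omega> or
  on \<open>T\<close> touches locally, which \<open>sub_at_local_test\<close> accepts.\<close>

lemma visc_sub_iff:
  assumes v: "continuous_on (closure \<Omega>) v"
  shows "visc_sub \<Omega> (outer_normal \<rho>) \<Lambda> v \<longleftrightarrow> (\<forall>x\<in>closure \<Omega>. sub_at \<Lambda> v x)"
proof
  assume L: "visc_sub \<Omega> (outer_normal \<rho>) \<Lambda> v"
  show "\<forall>x\<in>closure \<Omega>. sub_at \<Lambda> v x"
  proof
    fix x assume x: "x \<in> closure \<Omega>"
    show "sub_at \<Lambda> v x"
      unfolding sub_at_def
    proof (intro allI impI)
      fix \<phi> g H
      assume *: "C2_on UNIV \<phi> g H \<and> \<phi> x = v x \<and> (\<forall>y\<in>closure \<Omega>. y \<noteq> x \<longrightarrow> v y < \<phi> y)"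
      consider "x \<in> \<Omega>" | "x \<in> frontier \<Omega>" using x closure_cases by blast
      then show "sub_cond \<Lambda> x (v x) (g x) (H x (g x) \<bullet> g x)"
      proof cases
        case 1
        have "C2_on \<Omega> \<phi> g H" using * C2_on_subset open_\<Omega> by blast
        then show ?thesis
          using L 1 * closure_subset[of \<Omega>] unfolding visc_sub_def sub_cond_def by (metis subsetD)
      next
        case 2
        then have "min (E_op \<Lambda> (\<phi> x) (g x) (H x (g x) \<bullet> g x)) (g x \<bullet> outer_normal \<rho> x) \<le> 0"
          using L * unfolding visc_sub_def by blast
        then show ?thesis
          using * 2 unfolding sub_cond_def
          by (simp add: min_le_iff_disj inner_outer_normal_sign)
      qed
    qed
  qed
next
  assume R: "\<forall>x\<in>closure \<Omega>. sub_at \<Lambda> v x"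
  show "visc_sub \<Omega> (outer_normal \<rho>) \<Lambda> v"
    unfolding visc_sub_def
  proof (intro conjI ballI allI impI)
    fix x \<phi> g H
    assume x: "x \<in> \<Omega>"
      and *: "C2_on \<Omega> \<phi> g H \<and> \<phi> x = v x \<and> (\<forall>y\<in>\<Omega>. y \<noteq> x \<longrightarrow> v y < \<phi> y)"
    obtain e where e: "e > 0" "ball x e \<subseteq> \<Omega>" using open_\<Omega> x open_contains_ball by blast
    have le: "v y - v x \<le> \<phi> y - \<phi> x" if "dist y x < e" for y
      using e * that by (cases "y = x") (auto simp: dist_commute subset_iff intro: less_imp_le)
    have "sub_cond \<Lambda> x (v x) (g x) (H x (g x) \<bullet> g x)"
      using R x closure_subset[of \<Omega>] * le e(1)
      by (intro sub_at_local_test[OF _ v, where e=e and T=\<Omega> and \<phi>=\<phi>]) auto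
    then show "E_op \<Lambda> (\<phi> x) (g x) (H x (g x) \<bullet> g x) \<le> 0"
      using frontier_disjoint x * by (auto simp: sub_cond_def)
  next
    fix x \<phi> g H T
    assume x: "x \<in> frontier \<Omega>"
      and *: "closure \<Omega> \<subseteq> T \<and> C2_on T \<phi> g H \<and> \<phi> x = v x \<and> (\<forall>y\<in>closure \<Omega>. y \<noteq> x \<longrightarrow> v y < \<phi> y)"
    have xc: "x \<in> closure \<Omega>" using x closure_cases by blast
    have le: "v y - v x \<le> \<phi> y - \<phi> x" if "y \<in> closure \<Omega>" for y
      using * that by (cases "y = x") (auto intro: less_imp_le)
    have "sub_cond \<Lambda> x (v x) (g x) (H x (g x) \<bullet> g x)"
      using R xc * le
      by (intro sub_at_local_test[OF _ v, where e=1 and T=T and \<phi>=\<phi>]) auto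
    then show "min (E_op \<Lambda> (\<phi> x) (g x) (H x (g x) \<bullet> g x)) (g x \<bullet> outer_normal \<rho> x) \<le> 0"
      using * by (auto simp: sub_cond_def min_le_iff_disj inner_outer_normal_sign)
  qed
qed

section \<open>Reflection between sub- and supersolutions\<close>

lemma E_op_test_uminus:
  assumes "linear A"
  shows "E_op \<Lambda> (- s) (- p) ((- A (- p)) \<bullet> (- p)) = - E_op \<Lambda> s p (A p \<bullet> p)"
  using E_op_uminus[of \<Lambda> s p "A p \<bullet> p"] by (simp add: linear_neg[OF assms])

text \<open>The operator is odd: changing the signs of value, gradient and Hessian exchanges the
  regimes \<open>F\<close> and \<open>G\<close>. From here on only subsolutions are studied, applied
  to \<open>u\<close> and to its negative.\<close>

lemma visc_super_iff:
  "visc_super \<Omega> \<nu> \<Lambda> u \<longleftrightarrow> visc_sub \<Omega> \<nu> \<Lambda> (\<lambda>x. - u x)"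
proof
  assume L: "visc_super \<Omega> \<nu> \<Lambda> u"
  show "visc_sub \<Omega> \<nu> \<Lambda> (\<lambda>x. - u x)"
    unfolding visc_sub_def
  proof (intro conjI ballI allI impI)
    fix x \<phi> g H
    assume x: "x \<in> \<Omega>"
      and *: "C2_on \<Omega> \<phi> g H \<and> \<phi> x = - u x \<and> (\<forall>y\<in>\<Omega>. y \<noteq> x \<longrightarrow> - u y < \<phi> y)"
    then have lin: "linear (H x)" by (blast intro: C2_on_linear)
    have "E_op \<Lambda> (- \<phi> x) (- g x) ((- H x (- g x)) \<bullet> (- g x)) \<ge> 0"
      using conjunct1[OF L[unfolded visc_super_def], rule_format, OF x,
          of "\<lambda>y. - \<phi> y" "\<lambda>y. - g y" "\<lambda>y h. - H y h"]
        C2_on_uminus[of \<Omega> \<phi> g H] * by fastforce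
    then show "E_op \<Lambda> (\<phi> x) (g x) (H x (g x) \<bullet> g x) \<le> 0"
      unfolding E_op_test_uminus[OF lin] by simp
  next
    fix x \<phi> g H T
    assume x: "x \<in> frontier \<Omega>" and *: "closure \<Omega> \<subseteq> T \<and> C2_on T \<phi> g H \<and> \<phi> x = - u x \<and>
      (\<forall>y\<in>closure \<Omega>. y \<noteq> x \<longrightarrow> - u y < \<phi> y)"
    then have lin: "linear (H x)" using closure_cases by (blast intro: C2_on_linear)
    have "C2_on T (\<lambda>y. - \<phi> y) (\<lambda>y. - g y) (\<lambda>y h. - H y h)"
      and "\<forall>y\<in>closure \<Omega>. y \<noteq> x \<longrightarrow> u y > - \<phi> y"
      using * C2_on_uminus by fastforce+
    then have "max (E_op \<Lambda> (- \<phi> x) (- g x) ((- H x (- g x)) \<bullet> (- g x))) ((- g x) \<bullet> \<nu> x) \<ge> 0"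
      using conjunct2[OF L[unfolded visc_super_def], rule_format, OF x,
          of T "\<lambda>y. - \<phi> y" "\<lambda>y. - g y" "\<lambda>y h. - H y h"] * by simp
    then show "min (E_op \<Lambda> (\<phi> x) (g x) (H x (g x) \<bullet> g x)) (g x \<bullet> \<nu> x) \<le> 0"
      unfolding E_op_test_uminus[OF lin] by (simp add: le_max_iff_disj min_le_iff_disj)
  qed
next
  assume L: "visc_sub \<Omega> \<nu> \<Lambda> (\<lambda>x. - u x)"
  show "visc_super \<Omega> \<nu> \<Lambda> u"
    unfolding visc_super_def
  proof (intro conjI ballI allI impI)
    fix x \<phi> g H
    assume x: "x \<in> \<Omega>"
      and *: "C2_on \<Omega> \<phi> g H \<and> \<phi> x = u x \<and> (\<forall>y\<in>\<Omega>. y \<noteq> x \<longrightarrow> u y > \<phi> y)"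
    then have lin: "linear (H x)" by (blast intro: C2_on_linear)
    have "E_op \<Lambda> (- \<phi> x) (- g x) ((- H x (- g x)) \<bullet> (- g x)) \<le> 0"
      using conjunct1[OF L[unfolded visc_sub_def], rule_format, OF x,
          of "\<lambda>y. - \<phi> y" "\<lambda>y. - g y" "\<lambda>y h. - H y h"]
        C2_on_uminus[of \<Omega> \<phi> g H] * by fastforce
    then show "E_op \<Lambda> (\<phi> x) (g x) (H x (g x) \<bullet> g x) \<ge> 0"
      unfolding E_op_test_uminus[OF lin] by simp
  next
    fix x \<phi> g H T
    assume x: "x \<in> frontier \<Omega>" and *: "closure \<Omega> \<subseteq> T \<and> C2_on T \<phi> g H \<and> \<phi> x = u x \<and>
      (\<forall>y\<in>closure \<Omega>. y \<noteq> x \<longrightarrow> u y > \<phi> y)"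
    then have lin: "linear (H x)" using closure_cases by (blast intro: C2_on_linear)
    have "C2_on T (\<lambda>y. - \<phi> y) (\<lambda>y. - g y) (\<lambda>y h. - H y h)"
      and "\<forall>y\<in>closure \<Omega>. y \<noteq> x \<longrightarrow> - u y < - \<phi> y"
      using * C2_on_uminus by fastforce+
    then have "min (E_op \<Lambda> (- \<phi> x) (- g x) ((- H x (- g x)) \<bullet> (- g x))) ((- g x) \<bullet> \<nu> x) \<le> 0"
      using conjunct2[OF L[unfolded visc_sub_def], rule_format, OF x,
          of T "\<lambda>y. - \<phi> y" "\<lambda>y. - g y" "\<lambda>y h. - H y h"] * by simp
    then show "max (E_op \<Lambda> (\<phi> x) (g x) (H x (g x) \<bullet> g x)) (g x \<bullet> \<nu> x) \<ge> 0"
      unfolding E_op_test_uminus[OF lin] by (simp add: le_max_iff_disj min_le_iff_disj)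
  qed
qed

subsection \<open>Comparison with cones and the strong maximum principle\<close>

lemma attains_max:
  assumes "continuous_on (closure \<Omega>) f"
  obtains y where "y \<in> closure \<Omega>" "\<And>x. x \<in> closure \<Omega> \<Longrightarrow> f x \<le> (f y :: real)"
  using continuous_attains_sup[OF compact_closure _ assms] nonempty by auto

text \<open>A test function increasing radially from an interior point has positive normal
  derivative by \<open>grad_inward\<close>, so the boundary alternative is excluded. For
  \<open>s <= 0\<close> a negative \<open>q\<close> alone makes the operator positive; for
  \<open>s > 0\<close> the slope must also exceed \<open>\<Lambda> * s\<close>.\<close>

lemma sub_cond_radial_False:
  assumes x: "x \<in> closure \<Omega>" and z: "z \<in> \<Omega>" "x \<noteq> z" and c: "c > 0" and q: "q < 0"
    and s: "s \<le> 0 \<or> \<Lambda> * s < norm (c *\<^sub>R (x - z))"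
  shows "\<not> sub_cond \<Lambda> x s (c *\<^sub>R (x - z)) q"
proof -
  have "(c *\<^sub>R (x - z)) \<bullet> grad \<rho> x > 0" if "x \<in> frontier \<Omega>"
    using grad_inward[OF that z(1)] c by (simp add: inner_commute)
  moreover have "E_op \<Lambda> s (c *\<^sub>R (x - z)) q > 0"
    using q s unfolding E_op_def by (auto simp: less_max_iff_disj)
  ultimately show ?thesis unfolding sub_cond_def by auto
qed

text \<open>At points where \<open>v\<close> need not be a subsolution the conclusion itself may be
  assumed. Perron's family uses this at its two exceptional points.\<close>

lemma sub_cone_comparison_interior:
  assumes v: "continuous_on (closure \<Omega>) v" and \<Lambda>: "\<Lambda> \<ge> 0" and M: "M \<ge> 0"
    and le: "\<And>x. x \<in> closure \<Omega> \<Longrightarrow> v x \<le> M" and z: "z \<in> \<Omega>"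
    and sub: "\<And>x. x \<in> closure \<Omega> \<Longrightarrow> x \<noteq> z \<Longrightarrow> sub_at \<Lambda> v x \<or> v x \<le> v z + \<Lambda> * M * norm (x - z)"
    and x: "x \<in> closure \<Omega>"
  shows "v x \<le> v z + \<Lambda> * M * norm (x - z)"
proof (rule le_of_perturbation)
  fix \<eta> :: real assume \<eta>: "\<eta> > 0"
  obtain D where D: "D > 0" "\<And>x. x \<in> closure \<Omega> \<Longrightarrow> norm (x - z) \<le> D"
  proof -
    have "bounded ((\<lambda>x. x - z) ` closure \<Omega>)"
      using bounded_translation[of "closure \<Omega>" "- z"] bounded_\<Omega> by (simp add: bounded_closure)
    then show ?thesis using that unfolding bounded_pos by auto
  qed
  define c where "c = \<Lambda> * M + \<eta>"
  \<comment> \<open>The bending lowers the slope by \<open>2 * b * r\<close>, at most half of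
    \<eta>, so the slope still exceeds \<open>\<Lambda> * M\<close> throughout the closure.\<close>
  define b where "b = \<eta> / (4 * D)"
  have b: "b > 0" using \<eta> D by (simp add: b_def)
  have bD: "b * norm (y - z) \<le> \<eta> / 4" if "y \<in> closure \<Omega>" for y
  proof -
    have "b * norm (y - z) \<le> b * D" using b D that by simp
    also have "\<dots> = \<eta> / 4" using D by (simp add: b_def)
    finally show ?thesis .
  qed
  define \<phi> where "\<phi> y = c * norm (y - z) - b * (norm (y - z))\<^sup>2" for y
  note C = C2_on_cone[of z c b, folded \<phi>_def]
  have cont: "continuous_on (closure \<Omega>) (\<lambda>y. v y - \<phi> y)"
    unfolding \<phi>_def by (intro continuous_intros v)
  obtain y where y: "y \<in> closure \<Omega>" "\<And>x. x \<in> closure \<Omega> \<Longrightarrow> v x - \<phi> x \<le> v y - \<phi> y"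
    using attains_max[OF cont] by metis
  have "v y \<le> v z + \<phi> y"
  proof (cases "y = z")
    case True then show ?thesis by (simp add: \<phi>_def)
  next
    case False
    define r where "r = norm (y - z)"
    have r: "r > 0" using False by (simp add: r_def)
    have br: "b * r \<le> \<eta> / 4" using bD[OF y(1)] by (simp add: r_def)
    have pos: "\<Lambda> * M < c - 2 * (b * r)" using br \<eta> by (simp add: c_def)
    then have cp: "c - 2 * (b * r) > 0" using \<Lambda> M by (meson mult_nonneg_nonneg order_le_less_trans)
    define k where "k = c / r - 2 * b"
    have k: "k = (c - 2 * (b * r)) / r" using r by (simp add: k_def field_simps)
    define p where "p = k *\<^sub>R (y - z)"
    have kp: "k > 0" using cp r by (simp add: k)
    have mem: "y \<in> - {z}" using False by simp
    have touch: "v x - v y \<le> \<phi> x - \<phi> y" if "x \<in> closure \<Omega>" for x using y(2)[OF that] by simp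
    have "\<not> sub_at \<Lambda> v y"
    proof
      assume "sub_at \<Lambda> v y"
      then have "sub_cond \<Lambda> y (v y) p
         ((k *\<^sub>R p - (c / r ^ 3 * ((y - z) \<bullet> p)) *\<^sub>R (y - z)) \<bullet> p)"
        by (rule sub_at_local_test[OF _ v C mem zero_less_one touch, folded r_def, folded k_def, folded p_def])
      \<comment> \<open>The Hessian along the radial direction is \<open>- 2 * b\<close>, since the
        pure cone contributes nothing there.\<close>
      moreover have "(k *\<^sub>R p - (c / r ^ 3 * ((y - z) \<bullet> p)) *\<^sub>R (y - z)) \<bullet> p < 0"
      proof -
        have yz: "(y - z) \<bullet> (y - z) = r\<^sup>2" by (simp add: r_def power2_norm_eq_inner)
        have e: "(y - z) \<bullet> p = k * r\<^sup>2" "p \<bullet> p = k\<^sup>2 * r\<^sup>2"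
          by (simp_all add: p_def yz power2_eq_square)
        have "(k *\<^sub>R p - (c / r ^ 3 * ((y - z) \<bullet> p)) *\<^sub>R (y - z)) \<bullet> p =
          k * (k\<^sup>2 * r\<^sup>2) - c / r ^ 3 * (k * r\<^sup>2) * (k * r\<^sup>2)"
          unfolding inner_diff_left[of "k *\<^sub>R p"] inner_scaleR_left e ..
        also have "\<dots> = k\<^sup>2 * r\<^sup>2 * (k - c / r)"
          using r by (simp add: field_simps power2_eq_square power3_eq_cube)
        also have "k - c / r = - 2 * b" by (simp add: k_def)
        finally show ?thesis using kp r b by (simp add: mult_less_0_iff)
      qed
      moreover have "\<Lambda> * v y < norm p"
      proof -
        have "norm p = c - 2 * (b * r)"
          using kp r k cp by (simp add: p_def r_def[symmetric] abs_of_pos)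
        moreover have "\<Lambda> * v y \<le> \<Lambda> * M" using le[OF y(1)] \<Lambda> by (rule mult_left_mono)
        ultimately show ?thesis using pos by linarith
      qed
      ultimately show False
        using sub_cond_radial_False[OF y(1) z False kp, of _ "v y" \<Lambda>] unfolding p_def by blast
    qed
    \<comment> \<open>Only an exceptional maximum point remains. The bound assumed there is below
      \<phi>, because \<phi> is at least the cone of slope \<open>\<Lambda> * M\<close>.\<close>
    then have "v y \<le> v z + \<Lambda> * M * r" using sub[OF y(1) False] by (simp add: r_def)
    also have "\<Lambda> * M * r \<le> (c - b * r) * r"
      using r br \<eta> by (intro mult_right_mono) (auto simp: c_def)
    also have "\<dots> = \<phi> y" by (simp add: \<phi>_def r_def algebra_simps power2_eq_square)
    finally show ?thesis by simp
  qed
  then have "v x \<le> v z + \<phi> x" using y(2)[OF x] by simp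
  also have "\<phi> x \<le> c * norm (x - z)" using b by (simp add: \<phi>_def)
  finally show "v x \<le> v z + \<Lambda> * M * norm (x - z) + \<eta> * norm (x - z)"
    by (simp add: c_def algebra_simps)
qed

text \<open>\<open>grad_inward\<close> needs an interior vertex; continuity in \<open>z\<close>
  carries the cone estimate to vertices on the boundary.\<close>

lemma le_on_closure:
  assumes v: "continuous_on (closure \<Omega>) v" and le: "\<And>z. z \<in> \<Omega> \<Longrightarrow> A \<le> v z + c * norm (x - z)"
    and z: "z \<in> closure \<Omega>"
  shows "A \<le> v z + c * norm (x - z)"
  by (rule continuous_ge_on_closure[OF _ z]) (auto intro!: continuous_intros v le)

lemma sub_cone_comparison:
  assumes "continuous_on (closure \<Omega>) v" "\<Lambda> \<ge> 0" "M \<ge> 0"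
    and "\<And>x. x \<in> closure \<Omega> \<Longrightarrow> v x \<le> M" "\<And>x. x \<in> closure \<Omega> \<Longrightarrow> sub_at \<Lambda> v x"
    and "x \<in> closure \<Omega>" "z \<in> closure \<Omega>"
  shows "v x \<le> v z + \<Lambda> * M * norm (x - z)"
  by (rule le_on_closure) (use assms sub_cone_comparison_interior in auto)

text \<open>For nonpositive values the operator is at least \<open>- q\<close>, so no radially
  increasing test function with negative \<open>q\<close> can touch \<open>v\<close> from above away
  from its interior centre. If \<open>v z\<close> were below the maximum, a negative Gaussian
  centred at \<open>z\<close> would be such a function.\<close>

lemma sub_strong_maximum:
  assumes v: "continuous_on (closure \<Omega>) v"
    and sub: "\<And>x. x \<in> closure \<Omega> \<Longrightarrow> sub_at \<Lambda> v x"
    and le: "\<And>x. x \<in> closure \<Omega> \<Longrightarrow> v x \<le> 0"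
  shows "\<not> nonconstant_on (closure \<Omega>) v"
proof -
  obtain x1 where x1: "x1 \<in> closure \<Omega>" "\<And>x. x \<in> closure \<Omega> \<Longrightarrow> v x \<le> v x1"
    using attains_max[OF v] by metis
  have "v x1 \<le> v z" if z: "z \<in> \<Omega>" for z
  proof (rule ccontr)
    assume "\<not> v x1 \<le> v z"
    define \<epsilon> where "\<epsilon> = (v x1 - v z) / 2"
    have \<epsilon>: "\<epsilon> > 0" using \<open>\<not> v x1 \<le> v z\<close> by (simp add: \<epsilon>_def)
    have zc: "z \<in> closure \<Omega>" using z closure_subset by blast
    obtain r where r: "r > 0" "\<And>x. x \<in> closure \<Omega> \<Longrightarrow> dist x z < r \<Longrightarrow> dist (v x) (v z) < \<epsilon>"
      using v zc \<epsilon> unfolding continuous_on_iff by metis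
    have near: "v x \<le> v x1 - \<epsilon>" if "x \<in> closure \<Omega>" "norm (x - z) < r" for x
    proof -
      have "\<bar>v x - v z\<bar> < \<epsilon>" using r(2)[of x] that by (simp add: dist_norm)
      then show ?thesis unfolding \<epsilon>_def by argo
    qed
    \<comment> \<open>This rate makes the factor \<open>1 - 2 * \<alpha> * t\<^sup>2\<close>
      negative for every distance \<open>t\<close> from \<open>z\<close> that is at least
      \<open>r\<close>.\<close>
    define \<alpha> where "\<alpha> = 1 / r\<^sup>2"
    have \<alpha>: "\<alpha> > 0" using r by (simp add: \<alpha>_def)
    define w where "w s = - \<epsilon> * exp (- \<alpha> * s)" for s
    define w1 where "w1 s = \<epsilon> * \<alpha> * exp (- \<alpha> * s)" for s
    define w2 where "w2 s = - \<epsilon> * \<alpha>\<^sup>2 * exp (- \<alpha> * s)" for s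
    define \<phi> where "\<phi> y = w ((y - z) \<bullet> (y - z))" for y
    have "(w has_field_derivative w1 s) (at s)" "(w1 has_field_derivative w2 s) (at s)" for s
      unfolding w_def[abs_def] w1_def[abs_def] w2_def
      by (auto intro!: derivative_eq_intros simp: power2_eq_square)
    moreover have "continuous_on UNIV w2"
      unfolding w2_def[abs_def] by (auto intro!: continuous_intros)
    ultimately have C: "C2_on {y. (y - z) \<bullet> (y - z) \<in> UNIV} \<phi>
       (\<lambda>y. (2 * w1 ((y - z) \<bullet> (y - z))) *\<^sub>R (y - z))
       (\<lambda>y h. (2 * w1 ((y - z) \<bullet> (y - z))) *\<^sub>R h
            + (4 * w2 ((y - z) \<bullet> (y - z)) * ((y - z) \<bullet> h)) *\<^sub>R (y - z))"
      unfolding \<phi>_def by (intro C2_on_radial) auto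
    have cont: "continuous_on (closure \<Omega>) (\<lambda>y. v y - \<phi> y)"
      unfolding \<phi>_def w_def by (intro continuous_intros v)
    obtain y where y: "y \<in> closure \<Omega>" "\<And>x. x \<in> closure \<Omega> \<Longrightarrow> v x - \<phi> x \<le> v y - \<phi> y"
      using attains_max[OF cont] by metis
    have "v x1 < v x1 - \<phi> x1" using \<epsilon> by (simp add: \<phi>_def w_def)
    also have "\<dots> \<le> v y - \<phi> y" using y x1 by blast
    finally have *: "v x1 < v y - \<phi> y" .
    have "- \<phi> y \<le> \<epsilon>" using \<epsilon> \<alpha> by (simp add: \<phi>_def w_def)
    then have ry: "r \<le> norm (y - z)" using * near[OF y(1)] by force
    define t where "t = norm (y - z)"
    have t: "t > 0" "r \<le> t" using r ry by (auto simp: t_def)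
    have s: "(y - z) \<bullet> (y - z) = t\<^sup>2" by (simp add: t_def power2_norm_eq_inner)
    define k where "k = 2 * w1 (t\<^sup>2)"
    define p where "p = k *\<^sub>R (y - z)"
    have kp: "k > 0" using \<epsilon> \<alpha> by (simp add: k_def w1_def)
    have yz: "y \<noteq> z" using t by (auto simp: t_def)
    have mem: "y \<in> {y. (y - z) \<bullet> (y - z) \<in> UNIV}" by simp
    have touch: "v x - v y \<le> \<phi> x - \<phi> y" if "x \<in> closure \<Omega>" for x using y(2)[OF that] by simp
    have "sub_cond \<Lambda> y (v y) p
       ((k *\<^sub>R p + (4 * w2 (t\<^sup>2) * ((y - z) \<bullet> p)) *\<^sub>R (y - z)) \<bullet> p)"
      by (rule sub_at_local_test[OF sub[OF y(1)] v C mem zero_less_one touch, unfolded s, folded k_def p_def])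
    moreover have "(k *\<^sub>R p + (4 * w2 (t\<^sup>2) * ((y - z) \<bullet> p)) *\<^sub>R (y - z)) \<bullet> p < 0"
    proof -
      have "(y - z) \<bullet> p = k * t\<^sup>2" "p \<bullet> p = k\<^sup>2 * t\<^sup>2"
        by (simp_all add: p_def s power2_eq_square)
      then have "(k *\<^sub>R p + (4 * w2 (t\<^sup>2) * ((y - z) \<bullet> p)) *\<^sub>R (y - z)) \<bullet> p =
        k\<^sup>2 * t\<^sup>2 * (k + 4 * w2 (t\<^sup>2) * t\<^sup>2)"
        by (simp add: inner_add_left algebra_simps power2_eq_square)
      also have "k + 4 * w2 (t\<^sup>2) * t\<^sup>2 = k * (1 - 2 * (\<alpha> * t\<^sup>2))"
        by (simp add: k_def w1_def w2_def algebra_simps power2_eq_square)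
      finally have eq: "(k *\<^sub>R p + (4 * w2 (t\<^sup>2) * ((y - z) \<bullet> p)) *\<^sub>R (y - z)) \<bullet> p =
        k\<^sup>2 * t\<^sup>2 * (k * (1 - 2 * (\<alpha> * t\<^sup>2)))" .
      have "r\<^sup>2 \<le> t\<^sup>2" using r t by (intro power_mono) auto
      then have "\<alpha> * t\<^sup>2 \<ge> 1" using r by (simp add: \<alpha>_def)
      then have "k * (1 - 2 * (\<alpha> * t\<^sup>2)) < 0" using kp by (intro mult_pos_neg) auto
      then show ?thesis unfolding eq by (rule mult_pos_neg[rotated]) (use kp t in simp)
    qed
    ultimately show False
      using sub_cond_radial_False[OF y(1) z yz kp, of _ "v y" \<Lambda>] le[OF y(1)] unfolding p_def by blast
  qed
  then have "v x1 \<le> v z" if "z \<in> closure \<Omega>" for z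
    using continuous_ge_on_closure[OF v that] by blast
  then show ?thesis
    unfolding nonconstant_on_def using x1 by (metis order_antisym)
qed

subsection \<open>The lower bound\<close>

lemma eigenvalue_lower_bound:
  assumes \<Lambda>: "\<Lambda> \<ge> 0" and sol: "visc_solution \<Omega> (outer_normal \<rho>) \<Lambda> u"
    and nc: "nonconstant_on (closure \<Omega>) u"
  shows "2 \<le> \<Lambda> * diameter \<Omega>"
proof -
  have u: "continuous_on (closure \<Omega>) u" and mu: "continuous_on (closure \<Omega>) (\<lambda>x. - u x)"
    using sol unfolding visc_solution_def by (auto intro: continuous_intros)
  have sub: "\<And>x. x \<in> closure \<Omega> \<Longrightarrow> sub_at \<Lambda> u x" "\<And>x. x \<in> closure \<Omega> \<Longrightarrow> sub_at \<Lambda> (\<lambda>x. - u x) x"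
    using sol visc_sub_iff[OF u] visc_sub_iff[OF mu]
    unfolding visc_solution_def visc_super_iff by blast+
  \<comment> \<open>This is used for \<open>u\<close> and for its negative. The point is a maximum
    point of \<open>v\<close>, and cone comparison with \<open>M = v x\<close> allows the positive
    factor \<open>v x\<close> to be cancelled.\<close>
  have key: "\<exists>x\<in>closure \<Omega>. v x > 0 \<and> (\<forall>z\<in>closure \<Omega>. v z = 0 \<longrightarrow> 1 \<le> \<Lambda> * norm (x - z))"
    if v: "continuous_on (closure \<Omega>) v" and sub: "\<And>x. x \<in> closure \<Omega> \<Longrightarrow> sub_at \<Lambda> v x"
      and nc: "nonconstant_on (closure \<Omega>) v" for v
  proof -
    obtain x where x: "x \<in> closure \<Omega>" "\<And>y. y \<in> closure \<Omega> \<Longrightarrow> v y \<le> v x"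
      using attains_max[OF v] by metis
    have pos: "v x > 0"
      using sub_strong_maximum[OF v sub] nc x by (meson not_le order_trans)
    have "1 \<le> \<Lambda> * norm (x - z)" if z: "z \<in> closure \<Omega>" "v z = 0" for z
    proof -
      have "v x \<le> v z + \<Lambda> * v x * norm (x - z)"
        using sub_cone_comparison[OF v \<Lambda> _ x(2) sub x(1) z(1)] pos by simp
      then have "v x * 1 \<le> v x * (\<Lambda> * norm (x - z))" using z by (simp add: algebra_simps)
      then show ?thesis using pos mult_le_cancel_left_pos by blast
    qed
    then show ?thesis using x pos by blast
  qed
  obtain x1 where x1: "x1 \<in> closure \<Omega>" "u x1 > 0"
    "\<And>z. z \<in> closure \<Omega> \<Longrightarrow> u z = 0 \<Longrightarrow> 1 \<le> \<Lambda> * norm (x1 - z)"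
    using key[OF u sub(1) nc] by blast
  have "nonconstant_on (closure \<Omega>) (\<lambda>x. - u x)" using nc unfolding nonconstant_on_def by simp
  then obtain x2 where x2: "x2 \<in> closure \<Omega>" "u x2 < 0"
    "\<And>z. z \<in> closure \<Omega> \<Longrightarrow> u z = 0 \<Longrightarrow> 1 \<le> \<Lambda> * norm (x2 - z)"
    using key[OF mu sub(2)] by auto
  have seg: "closed_segment x2 x1 \<subseteq> closure \<Omega>"
    using x1 x2 convex_closure' by (simp add: closed_segment_subset)
  then have "connected (u ` closed_segment x2 x1)"
    by (intro connected_continuous_image continuous_on_subset[OF u]) auto
  then have "0 \<in> u ` closed_segment x2 x1"
    using connected_contains_Icc[of _ "u x2" "u x1"] x1(2) x2(2) by fastforce
  then obtain z where z: "z \<in> closed_segment x2 x1" "u z = 0" by auto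
  have "dist x2 x1 = dist x2 z + dist z x1"
    using z(1) between_mem_segment between by metis
  moreover have "1 \<le> \<Lambda> * norm (x1 - z)" "1 \<le> \<Lambda> * norm (x2 - z)" using z seg x1 x2 by auto
  moreover have "dist x2 x1 \<le> diameter \<Omega>"
    using diameter_bounded_bound[of "closure \<Omega>" x2 x1] x1 x2 bounded_\<Omega>
    by (simp add: bounded_closure diameter_closure)
  then have "\<Lambda> * dist x2 x1 \<le> \<Lambda> * diameter \<Omega>" using \<Lambda> by (rule mult_left_mono)
  ultimately show ?thesis by (simp add: dist_norm norm_minus_commute algebra_simps)
qed

subsection \<open>Pointwise criteria for subsolutions\<close>

lemma directional_derivative_ge:
  fixes f :: "'a \<Rightarrow> real"
  assumes f: "C2_on T f g H" "x \<in> T"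
    and ge: "\<forall>\<^sub>F t in at_right 0. f x + t * c \<le> f (x + t *\<^sub>R h)"
  shows "c \<le> g x \<bullet> h"
proof (rule tendsto_lowerbound)
  have "(f has_derivative (\<lambda>h. g x \<bullet> h)) (at (x + 0 *\<^sub>R h))"
    using f unfolding C2_on_def by simp
  then have "((\<lambda>t. f (x + t *\<^sub>R h)) has_derivative (\<lambda>d. g x \<bullet> (d *\<^sub>R h))) (at 0)"
    by (intro has_derivative_compose[of "\<lambda>t. x + t *\<^sub>R h" _ _ _ f]) (auto intro!: derivative_eq_intros)
  then have "((\<lambda>t. f (x + t *\<^sub>R h)) has_field_derivative (g x \<bullet> h)) (at 0)"
    by (intro has_derivative_imp_has_field_derivative) auto
  then have "((\<lambda>t. (f (x + t *\<^sub>R h) - f x) / t) \<longlongrightarrow> g x \<bullet> h) (at 0)"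
    unfolding has_field_derivative_iff by simp
  then show "((\<lambda>t. (f (x + t *\<^sub>R h) - f x) / t) \<longlongrightarrow> g x \<bullet> h) (at_right 0)"
    by (rule tendsto_mono[rotated]) (simp add: at_le)
  show "\<forall>\<^sub>F t in at_right 0. c \<le> (f (x + t *\<^sub>R h) - f x) / t"
    using ge eventually_at_right_less[of "0::real"]
    by eventually_elim (simp add: le_divide_eq algebra_simps)
qed simp

text \<open>Bounds at a boundary point hold only on the closure, so only difference quotients along
  rays entering \<Omega> can be used.\<close>

lemma inward_derivative_ge:
  assumes f: "C2_on T f g H" "x \<in> T" and x: "x \<in> frontier \<Omega>" and h: "grad \<rho> x \<bullet> h < 0"
    and ge: "\<And>y. y \<in> closure \<Omega> \<Longrightarrow> f x - c * norm (y - x) \<le> f y"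
  shows "- c * norm h \<le> g x \<bullet> h"
proof (rule directional_derivative_ge[OF f])
  show "\<forall>\<^sub>F t in at_right 0. f x + t * (- c * norm h) \<le> f (x + t *\<^sub>R h)"
    using eventually_inward[OF x h] eventually_at_right_less[of "0::real"]
  proof eventually_elim
    case (elim t)
    then have "x + t *\<^sub>R h \<in> closure \<Omega>" using closure_subset by blast
    then show ?case using ge[of "x + t *\<^sub>R h"] elim by (simp add: algebra_simps)
  qed
qed

lemma grad_frontier_pos: "x \<in> frontier \<Omega> \<Longrightarrow> grad \<rho> x \<bullet> grad \<rho> x > 0"
  using defining unfolding smooth_defining_fun_def by auto

text \<open>A test function above \<open>v\<close> inherits the minimum at \<open>x\<close>, so its
  inward derivative is nonnegative and its normal derivative nonpositive.\<close>

lemma sub_at_boundary_min: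
  assumes x: "x \<in> frontier \<Omega>" and min: "\<And>y. y \<in> closure \<Omega> \<Longrightarrow> v x \<le> v y"
  shows "sub_at \<Lambda> v x"
  unfolding sub_at_def
proof (intro allI impI)
  fix \<phi> g H
  assume *: "C2_on UNIV \<phi> g H \<and> \<phi> x = v x \<and> (\<forall>y\<in>closure \<Omega>. y \<noteq> x \<longrightarrow> v y < \<phi> y)"
  have "\<phi> x \<le> \<phi> y" if "y \<in> closure \<Omega>" for y
    using * min[OF that] that by (cases "y = x") (auto intro: less_imp_le order_le_less_trans)
  then have "- 0 * norm (- grad \<rho> x) \<le> g x \<bullet> (- grad \<rho> x)"
    using * x grad_frontier_pos[OF x] by (intro inward_derivative_ge[of UNIV \<phi> g H]) auto
  then show "sub_cond \<Lambda> x (v x) (g x) (H x (g x) \<bullet> g x)"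
    using x by (simp add: sub_cond_def)
qed

text \<open>If the normal derivative is positive, the negative gradient points into \<Omega>. The
  one-sided Lipschitz bound along it forces the gradient norm to be at most 1, hence at most
  \<open>\<Lambda> * v x\<close>, and the first entry of the minimum is nonpositive.\<close>

lemma sub_at_boundary_peak:
  assumes x: "x \<in> frontier \<Omega>" and lip: "\<And>y. y \<in> closure \<Omega> \<Longrightarrow> v x - norm (y - x) \<le> v y"
    and pos: "v x > 0" "\<Lambda> * v x \<ge> 1"
  shows "sub_at \<Lambda> v x"
  unfolding sub_at_def
proof (intro allI impI)
  fix \<phi> g H
  assume *: "C2_on UNIV \<phi> g H \<and> \<phi> x = v x \<and> (\<forall>y\<in>closure \<Omega>. y \<noteq> x \<longrightarrow> v y < \<phi> y)"
  have ge: "\<phi> x - 1 * norm (y - x) \<le> \<phi> y" if "y \<in> closure \<Omega>" for y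
    using * lip[OF that] that by (cases "y = x") (auto intro: less_imp_le order_le_less_trans)
  show "sub_cond \<Lambda> x (v x) (g x) (H x (g x) \<bullet> g x)"
  proof (cases "g x \<bullet> grad \<rho> x \<le> 0")
    case True then show ?thesis using x by (simp add: sub_cond_def)
  next
    case False
    then have "- 1 * norm (- g x) \<le> g x \<bullet> (- g x)"
      using * x ge by (intro inward_derivative_ge[of UNIV \<phi> g H]) (auto simp: inner_commute)
    then have "norm (g x) * norm (g x) \<le> norm (g x) * 1"
      by (simp add: dot_square_norm power2_eq_square)
    moreover have "norm (g x) > 0" using False by auto
    ultimately have "norm (g x) \<le> 1" using mult_le_cancel_left_pos by blast
    then show ?thesis using pos by (simp add: sub_cond_def E_op_def min_le_iff_disj)
  qed
qed

text \<open>If \<phi> touches \<open>v\<close> from above while \<open>f\<close> touches it from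
  below, \<open>\<phi> - f\<close> has a minimum at \<open>x\<close>. In the interior the gradients
  agree and the Hessians are ordered; on the boundary the normal derivative of \<phi> is at most
  that of \<open>f\<close>.\<close>

lemma sub_at_classical:
  assumes f: "C2_on T f g H" "x \<in> T" and x: "x \<in> closure \<Omega>"
    and eq: "f x = v x" and le: "\<And>y. y \<in> closure \<Omega> \<Longrightarrow> f y \<le> v y"
    and int: "x \<in> \<Omega> \<Longrightarrow> E_op \<Lambda> (v x) (g x) (H x (g x) \<bullet> g x) \<le> 0"
    and bd: "x \<in> frontier \<Omega> \<Longrightarrow> g x \<bullet> grad \<rho> x \<le> 0"
  shows "sub_at \<Lambda> v x"
  unfolding sub_at_def
proof (intro allI impI)
  fix \<phi> k J
  assume *: "C2_on UNIV \<phi> k J \<and> \<phi> x = v x \<and> (\<forall>y\<in>closure \<Omega>. y \<noteq> x \<longrightarrow> v y < \<phi> y)"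
  have "open T" using f unfolding C2_on_def by blast
  then have "C2_on T \<phi> k J" using * C2_on_subset by blast
  note C = C2_on_add[OF this C2_on_uminus[OF f(1)]]
  have ge: "\<phi> x + - f x \<le> \<phi> y + - f y" if "y \<in> closure \<Omega>" for y
    using * eq le[OF that] that by (cases "y = x") (auto intro: less_imp_le order_le_less_trans)
  show "sub_cond \<Lambda> x (v x) (k x) (J x (k x) \<bullet> k x)"
  proof (cases "x \<in> \<Omega>")
    case True
    have ge': "\<phi> x + - f x \<le> \<phi> y + - f y" if "y \<in> \<Omega>" for y
      using ge that closure_subset by blast
    have "k x = g x" using C2_on_minimum(1)[OF C f(2) open_\<Omega> True ge'] by simp
    moreover have "H x (g x) \<bullet> g x \<le> J x (g x) \<bullet> g x"
      using C2_on_minimum(2)[OF C f(2) open_\<Omega> True ge', of "g x"] by (simp add: inner_diff_left)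
    ultimately show ?thesis
      using int[OF True] E_op_antimono[of "H x (g x) \<bullet> g x" "J x (g x) \<bullet> g x" \<Lambda> "v x" "g x"]
      by (simp add: sub_cond_def)
  next
    case False
    then have fr: "x \<in> frontier \<Omega>" using x closure_cases by blast
    have "- 0 * norm (- grad \<rho> x) \<le> (k x + - g x) \<bullet> (- grad \<rho> x)"
      using fr grad_frontier_pos[OF fr] ge by (intro inward_derivative_ge[OF C f(2)]) auto
    then have "k x \<bullet> grad \<rho> x \<le> g x \<bullet> grad \<rho> x" by (simp add: inner_diff_left)
    then show ?thesis using bd[OF fr] fr by (simp add: sub_cond_def)
  qed
qed

text \<open>\<open>E_op_pos_iff\<close> writes positivity of the operator through strict
  inequalities between continuous functions, so failure persists when point and value are perturbed
  independently, even across \<open>s = 0\<close>.\<close>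

lemma sub_cond_fails_nearby:
  assumes \<Lambda>: "\<Lambda> \<ge> 0" and \<phi>: "C2_on UNIV \<phi> g H" and y: "y \<in> closure \<Omega>"
    and not: "\<not> sub_cond \<Lambda> y s0 (g y) (H y (g y) \<bullet> g y)"
  obtains r where "r > 0" "\<And>x s. dist x y < r \<Longrightarrow> \<bar>s - s0\<bar> < r \<Longrightarrow>
    \<not> sub_cond \<Lambda> x s (g x) (H x (g x) \<bullet> g x)"
proof -
  define q where "q x = H x (g x) \<bullet> g x" for x
  have q0: "g x = 0 \<Longrightarrow> q x = 0" for x by (simp add: q_def)
  have cg: "continuous_on UNIV g" and cq: "continuous_on UNIV q"
    using C2_on_continuous[OF \<phi>] unfolding q_def by auto
  have cg': "continuous_on UNIV (\<lambda>z :: real \<times> 'a. g (snd z))"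
    and cq': "continuous_on UNIV (\<lambda>z :: real \<times> 'a. q (snd z))"
    by (rule continuous_on_compose2[OF cg], auto intro: continuous_intros,
        rule continuous_on_compose2[OF cq], auto intro: continuous_intros)
  define A where "A = ({z. q (snd z) < 0} \<inter> {z. \<Lambda> * fst z < norm (g (snd z))})
    \<union> {z. norm (g (snd z)) < - \<Lambda> * fst z}"
  have "open A"
    unfolding A_def by (intro open_Un open_Int open_Collect_less continuous_intros cg' cq')
  have A: "(s, x) \<in> A \<longleftrightarrow> E_op \<Lambda> s (g x) (q x) > 0" for s x
    using E_op_pos_iff[OF \<Lambda>, of "g x" "q x" s] q0 by (auto simp: A_def)
  \<comment> \<open>Near an interior point there are no boundary points; near a boundary point the
    normal derivative stays positive. Either way the boundary alternative fails on
    \<open>B\<close>.\<close>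
  define B where "B = (if y \<in> \<Omega> then \<Omega> else {x. 0 < g x \<bullet> grad \<rho> x})"
  have "open B"
    unfolding B_def using open_\<Omega> open_Collect_less[of "\<lambda>x. 0" "\<lambda>x. g x \<bullet> grad \<rho> x"]
    by (auto intro!: continuous_intros cg continuous_on_grad)
  have "(s0, y) \<in> A" using not by (simp add: A sub_cond_def q_def)
  moreover have "y \<in> B" using not y closure_cases by (auto simp: B_def sub_cond_def)
  ultimately obtain e1 e2 where e: "e1 > 0" "ball (s0, y) e1 \<subseteq> A" "e2 > 0" "ball y e2 \<subseteq> B"
    using \<open>open A\<close> \<open>open B\<close> open_contains_ball by metis
  define r where "r = min (e1 / 2) e2"
  have "\<not> sub_cond \<Lambda> x s (g x) (H x (g x) \<bullet> g x)" if "dist x y < r" "\<bar>s - s0\<bar> < r" for x s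
  proof -
    have "dist (s0, y) (s, x) \<le> dist s0 s + dist y x"
      unfolding dist_Pair_Pair by (rule sqrt_sum_squares_le_sum) auto
    also have "\<dots> < e1" using that by (simp add: r_def dist_real_def dist_commute abs_minus_commute)
    finally have "(s, x) \<in> A" using e by auto
    moreover have "x \<in> B" using e that by (auto simp: r_def dist_commute)
    then have "\<not> (x \<in> frontier \<Omega> \<and> g x \<bullet> grad \<rho> x \<le> 0)"
      using frontier_disjoint by (auto simp: B_def split: if_splits)
    ultimately show ?thesis by (auto simp: A sub_cond_def q_def)
  qed
  moreover have "r > 0" using e by (simp add: r_def)
  ultimately show ?thesis using that by blast
qed

subsection \<open>Perron's method\<close>

text \<open>A test function violating the condition for \<open>u\<close> at \<open>y\<close> also
  violates it nearby. A member of \<open>P\<close> almost attaining \<open>u y\<close> is touched,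
  after a vertical shift, at such a nearby point with a nearby value, which contradicts its own
  condition.\<close>

lemma sub_at_Sup:
  assumes \<Lambda>: "\<Lambda> \<ge> 0" and y: "y \<in> closure \<Omega>" and u: "continuous_on (closure \<Omega>) u"
    and P: "\<And>v. v \<in> P \<Longrightarrow> continuous_on (closure \<Omega>) v"
      "\<And>v x. v \<in> P \<Longrightarrow> x \<in> closure \<Omega> \<Longrightarrow> v x \<le> u x"
      "\<And>\<delta>. \<delta> > 0 \<Longrightarrow> \<exists>v\<in>P. u y - \<delta> < v y"
    and N: "open N" "y \<in> N" "\<And>v x. v \<in> P \<Longrightarrow> x \<in> closure \<Omega> \<inter> N \<Longrightarrow> sub_at \<Lambda> v x"
  shows "sub_at \<Lambda> u y"
  unfolding sub_at_def
proof (intro allI impI, rule ccontr)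
  fix \<phi> g H
  assume *: "C2_on UNIV \<phi> g H \<and> \<phi> y = u y \<and> (\<forall>x\<in>closure \<Omega>. x \<noteq> y \<longrightarrow> u x < \<phi> x)"
    and not: "\<not> sub_cond \<Lambda> y (u y) (g y) (H y (g y) \<bullet> g y)"
  have C: "C2_on UNIV \<phi> g H" using * by blast
  have c\<phi>: "continuous_on UNIV \<phi>" using C2_on_continuous(1)[OF C] .
  have le: "u x \<le> \<phi> x" if "x \<in> closure \<Omega>" for x
    using * that by (cases "x = y") (auto intro: less_imp_le)
  obtain r where r: "r > 0" "\<And>x s. dist x y < r \<Longrightarrow> \<bar>s - u y\<bar> < r \<Longrightarrow>
    \<not> sub_cond \<Lambda> x s (g x) (H x (g x) \<bullet> g x)"
    using sub_cond_fails_nearby[OF \<Lambda> C y not] by metis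
  obtain d1 where d1: "d1 > 0" "ball y d1 \<subseteq> N" using N open_contains_ball by blast
  obtain d2 where d2: "d2 > 0" "\<And>x. dist x y < d2 \<Longrightarrow> dist (\<phi> x) (\<phi> y) < r / 2"
    using c\<phi>[unfolded continuous_on_iff, rule_format, of y "r / 2"] r(1) by auto
  define e where "e = min r (min d1 d2)"
  have e: "e > 0" using r d1 d2 by (simp add: e_def)
  have k1: "compact (closure \<Omega> - ball y e)" using compact_closure by (simp add: compact_diff)
  have k2: "continuous_on (closure \<Omega> - ball y e) (\<lambda>x. \<phi> x - u x)"
    by (intro continuous_intros continuous_on_subset[OF u] continuous_on_subset[OF c\<phi>]) auto
  have k3: "\<phi> x - u x > 0" if "x \<in> closure \<Omega> - ball y e" for x
    using that * e by force
  obtain \<delta>0 where \<delta>0: "\<delta>0 > 0" "\<And>x. x \<in> closure \<Omega> - ball y e \<Longrightarrow> \<delta>0 \<le> \<phi> x - u x"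
    using compact_gap[OF k1 k2 k3] by metis
  \<comment> \<open>Below the gap \<delta>0 the maximum of \<open>v - \<phi>\<close> must lie in the
    ball; the bound \<open>r / 2\<close> keeps \<open>v x\<close> close to
    \<open>u y\<close>.\<close>
  define \<delta> where "\<delta> = min \<delta>0 (r / 2)"
  have "\<delta> > 0" using \<delta>0 r by (simp add: \<delta>_def)
  then obtain v where v: "v \<in> P" "u y - \<delta> < v y" using P(3) by blast
  have cv: "continuous_on (closure \<Omega>) v" using P(1) v by blast
  then have "continuous_on (closure \<Omega>) (\<lambda>x. v x - \<phi> x)"
    by (intro continuous_intros continuous_on_subset[OF c\<phi>]) auto
  from attains_max[OF this] obtain x where
    x: "x \<in> closure \<Omega>" "\<And>z. z \<in> closure \<Omega> \<Longrightarrow> v z - \<phi> z \<le> v x - \<phi> x" by metis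
  have gt: "- \<delta> < v x - \<phi> x" using x(2)[OF y] v(2) * by simp
  have vu: "v x \<le> u x" using P(2) v x by blast
  have "x \<in> ball y e"
    using \<delta>0(2)[of x] x(1) gt vu by (cases "x \<in> ball y e") (auto simp: \<delta>_def)
  then have dx: "dist x y < r" "dist x y < d1" "dist x y < d2" by (auto simp: e_def dist_commute)
  have "\<bar>\<phi> x - u y\<bar> < r / 2" using d2(2)[OF dx(3)] * by (simp add: dist_real_def)
  moreover have "\<delta> \<le> r / 2" by (simp add: \<delta>_def)
  ultimately have "\<bar>v x - u y\<bar> < r" using gt vu le[OF x(1)] by linarith
  then have "\<not> sub_cond \<Lambda> x (v x) (g x) (H x (g x) \<bullet> g x)" using r(2) dx by blast
  moreover have "x \<in> N" using d1 dx by (auto simp: dist_commute)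
  then have "sub_at \<Lambda> v x" using N(3) v x by blast
  then have "sub_cond \<Lambda> x (v x) (g x) (H x (g x) \<bullet> g x)"
    by (rule sub_at_local_test[OF _ cv C _ zero_less_one]) (use x in \<open>auto simp: algebra_simps\<close>)
  ultimately show False by blast
qed

text \<open>If the supersolution condition fails at \<open>x0\<close>, a witness
  \<open>- \<psi>\<close> touches \<open>u\<close> strictly from below and satisfies the strict
  opposite inequalities nearby. Raised slightly and joined to \<open>u\<close> by a maximum, it
  changes \<open>u\<close> only near \<open>x0\<close>, where the new part is a classical
  subsolution.\<close>

lemma subsolution_bump:
  assumes \<Lambda>: "\<Lambda> \<ge> 0" and x0: "x0 \<in> closure \<Omega>" and u: "continuous_on (closure \<Omega>) u"
    and not: "\<not> sub_at \<Lambda> (\<lambda>x. - u x) x0" and N: "open N" "x0 \<in> N" and d: "d > 0"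
  obtains w where "continuous_on (closure \<Omega>) w" "u x0 < w x0"
    "\<And>x. u x \<le> w x"
    "\<And>x. x \<in> closure \<Omega> \<Longrightarrow> w x \<noteq> u x \<Longrightarrow> x \<in> N \<and> w x \<le> u x0 + d"
    "\<And>x. x \<in> closure \<Omega> \<Longrightarrow> w x \<noteq> u x \<or> sub_at \<Lambda> u x \<Longrightarrow> sub_at \<Lambda> w x"
proof -
  obtain \<psi> g H where C: "C2_on UNIV \<psi> g H" and \<psi>0: "\<psi> x0 = - u x0"
    and \<psi>: "\<And>x. x \<in> closure \<Omega> \<Longrightarrow> x \<noteq> x0 \<Longrightarrow> - u x < \<psi> x"
    and fail: "\<not> sub_cond \<Lambda> x0 (- u x0) (g x0) (H x0 (g x0) \<bullet> g x0)"
    using not unfolding sub_at_def by blast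
  have c\<psi>: "continuous_on UNIV \<psi>" using C2_on_continuous(1)[OF C] .
  obtain r where r: "r > 0" "\<And>x s. dist x x0 < r \<Longrightarrow> \<bar>s - (- u x0)\<bar> < r \<Longrightarrow>
    \<not> sub_cond \<Lambda> x s (g x) (H x (g x) \<bullet> g x)"
    using sub_cond_fails_nearby[OF \<Lambda> C x0 fail] by metis
  \<comment> \<open>The half leaves room for two errors, the oscillation of \<psi> and the lift
    \<delta>; together they stay within both \<open>r\<close> and \<open>d\<close>.\<close>
  define m where "m = min r d / 2"
  have m: "m > 0" using r d by (simp add: m_def)
  obtain d1 where d1: "d1 > 0" "ball x0 d1 \<subseteq> N" using N open_contains_ball by blast
  obtain d2 where d2: "d2 > 0" "\<And>x. dist x x0 < d2 \<Longrightarrow> dist (\<psi> x) (\<psi> x0) < m"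
    using c\<psi>[unfolded continuous_on_iff, rule_format, of x0 m] m by auto
  define e where "e = min r (min d1 d2)"
  have e: "e > 0" using r d1 d2 by (simp add: e_def)
  have k1: "compact (closure \<Omega> - ball x0 e)" using compact_closure by (simp add: compact_diff)
  have k2: "continuous_on (closure \<Omega> - ball x0 e) (\<lambda>x. \<psi> x + u x)"
    by (intro continuous_intros continuous_on_subset[OF u] continuous_on_subset[OF c\<psi>]) auto
  have k3: "\<psi> x + u x > 0" if "x \<in> closure \<Omega> - ball x0 e" for x
  proof -
    have "x \<in> closure \<Omega>" "x \<noteq> x0" using that e by auto
    then show ?thesis using \<psi>[of x] by linarith
  qed
  obtain \<delta>0 where \<delta>0: "\<delta>0 > 0" "\<And>x. x \<in> closure \<Omega> - ball x0 e \<Longrightarrow> \<delta>0 \<le> \<psi> x + u x"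
    using compact_gap[OF k1 k2 k3] by metis
  define \<delta> where "\<delta> = min \<delta>0 m"
  have \<delta>: "\<delta> > 0" "\<delta> \<le> \<delta>0" "\<delta> \<le> m" using \<delta>0 m by (auto simp: \<delta>_def)
  define w where "w x = max (u x) (\<delta> + - \<psi> x)" for x
  have near: "dist x x0 < e" "w x = \<delta> + - \<psi> x" "\<bar>\<psi> x + u x0\<bar> < m"
    if "x \<in> closure \<Omega>" "w x \<noteq> u x" for x
  proof -
    show wx: "w x = \<delta> + - \<psi> x" using that by (auto simp: w_def max_def split: if_splits)
    show de: "dist x x0 < e"
    proof (rule ccontr)
      assume "\<not> dist x x0 < e"
      then have "\<delta>0 \<le> \<psi> x + u x" using \<delta>0(2)[of x] that by (auto simp: dist_commute)
      then have "w x = u x" using \<delta> by (simp add: w_def)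
      then show False using that by blast
    qed
    then show "\<bar>\<psi> x + u x0\<bar> < m" using d2(2)[of x] \<psi>0 by (simp add: e_def dist_real_def)
  qed
  show ?thesis
  proof (rule that[of w])
    show "continuous_on (closure \<Omega>) w"
      unfolding w_def by (intro continuous_intros u continuous_on_subset[OF c\<psi>]) auto
    show "u x0 < w x0" using \<delta> \<psi>0 by (simp add: w_def)
    show "u x \<le> w x" for x by (simp add: w_def)
    show "x \<in> N \<and> w x \<le> u x0 + d" if "x \<in> closure \<Omega>" "w x \<noteq> u x" for x
    proof
      show "x \<in> N" using near(1)[OF that] d1 by (auto simp: e_def dist_commute)
      have "2 * m \<le> d" by (simp add: m_def)
      then show "w x \<le> u x0 + d" using near(2,3)[OF that] \<delta>(3) by linarith
    qed
    fix x assume x: "x \<in> closure \<Omega>" and alt: "w x \<noteq> u x \<or> sub_at \<Lambda> u x"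
    show "sub_at \<Lambda> w x"
    proof (cases "w x = u x")
      case True
      then have "sub_at \<Lambda> u x" using alt by blast
      moreover have "u z \<le> w z" for z by (simp add: w_def)
      ultimately show ?thesis using True unfolding sub_at_def by (metis order_le_less_trans)
    next
      case False
      note n = near[OF x False]
      have lin: "linear (H x)" using C C2_on_linear by blast
      have "2 * m \<le> r" by (simp add: m_def)
      then have "\<bar>- w x - (- u x0)\<bar> < r" using n(2,3) \<delta> by linarith
      then have f: "\<not> sub_cond \<Lambda> x (- w x) (g x) (H x (g x) \<bullet> g x)"
        using r(2)[of x] n(1) by (simp add: e_def)
      have C': "C2_on UNIV (\<lambda>x. \<delta> + - \<psi> x) (\<lambda>x. 0 + - g x) (\<lambda>x h. 0 + - H x h)"
        using C2_on_add[OF C2_on_affine[of \<delta> 0 x0] C2_on_uminus[OF C]] by simp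
      show ?thesis
      proof (rule sub_at_classical[OF C' _ x])
        show "\<delta> + - \<psi> x = w x" using n(2) by simp
        show "\<delta> + - \<psi> y \<le> w y" for y by (simp add: w_def)
        have "E_op \<Lambda> (- (- w x)) (- g x) ((- H x (- g x)) \<bullet> (- g x)) < 0"
          using f unfolding E_op_test_uminus[OF lin] by (simp add: sub_cond_def)
        then show "E_op \<Lambda> (w x) (0 + - g x) ((0 + - H x (0 + - g x)) \<bullet> (0 + - g x)) \<le> 0" by simp
        show "(0 + - g x) \<bullet> grad \<rho> x \<le> 0" if "x \<in> frontier \<Omega>"
          using f that by (simp add: sub_cond_def)
      qed simp
    qed
  qed
qed

subsection \<open>Existence for the critical value\<close>

lemma diameter_pos: "diameter \<Omega> > 0"
proof -
  obtain z e where z: "z \<in> \<Omega>" "e > 0" "ball z e \<subseteq> \<Omega>"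
    using nonempty open_\<Omega> open_contains_ball by blast
  obtain b :: 'a where b: "b \<in> Basis" using nonempty_Basis by blast
  then have d: "dist z (z + (e / 2) *\<^sub>R b) = e / 2" using z by (simp add: dist_norm)
  then have "z + (e / 2) *\<^sub>R b \<in> ball z e" unfolding mem_ball using z by simp
  then have "dist z (z + (e / 2) *\<^sub>R b) \<le> diameter \<Omega>"
    using z bounded_\<Omega> by (intro diameter_bounded_bound) auto
  then show ?thesis using d z by simp
qed

lemma dist_le_diameter: "x \<in> closure \<Omega> \<Longrightarrow> y \<in> closure \<Omega> \<Longrightarrow> norm (x - y) \<le> diameter \<Omega>"
  using diameter_bounded_bound[of "closure \<Omega>" x y] bounded_\<Omega>
  by (simp add: bounded_closure diameter_closure dist_norm)

text \<open>An interior endpoint could be moved away from \<open>y\<close> along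
  \<open>x - y\<close>, giving a distance larger than the diameter.\<close>

lemma diametral_in_frontier:
  assumes x: "x \<in> closure \<Omega>" and y: "y \<in> closure \<Omega>" and d: "diameter \<Omega> \<le> norm (x - y)"
  shows "x \<in> frontier \<Omega>"
proof (rule ccontr)
  assume "x \<notin> frontier \<Omega>"
  then have "x \<in> \<Omega>" using x closure_cases by blast
  have pos: "norm (x - y) > 0" using d diameter_pos by linarith
  have "((\<lambda>t. x + t *\<^sub>R (x - y)) \<longlongrightarrow> x + 0 *\<^sub>R (x - y)) (at_right (0::real))"
    by (intro tendsto_intros)
  then have "\<forall>\<^sub>F t in at_right (0::real). x + t *\<^sub>R (x - y) \<in> \<Omega>"
    using open_\<Omega> \<open>x \<in> \<Omega>\<close> by (intro topological_tendstoD) auto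
  then have "\<forall>\<^sub>F t in at_right (0::real). x + t *\<^sub>R (x - y) \<in> \<Omega> \<and> t > 0"
    by (intro eventually_conj eventually_at_right_less)
  then obtain t :: real where t: "t > 0" "x + t *\<^sub>R (x - y) \<in> \<Omega>"
    using eventually_happens[of _ "at_right (0::real)"] by auto
  then have "norm (x + t *\<^sub>R (x - y) - y) \<le> diameter \<Omega>"
    using dist_le_diameter[OF _ y] closure_subset by blast
  also have "x + t *\<^sub>R (x - y) - y = (1 + t) *\<^sub>R (x - y)" by (simp add: algebra_simps)
  also have "norm \<dots> = norm (x - y) + t * norm (x - y)"
    unfolding norm_scaleR using t by (simp add: distrib_right)
  finally show False using d pos t by (smt (verit) mult_pos_pos)
qed

lemma critical_solution_exists:
  "\<exists>u (L::real). visc_solution \<Omega> (outer_normal \<rho>) (2 / diameter \<Omega>) u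
     \<and> nonconstant_on (closure \<Omega>) u \<and> lipschitz_on L (closure \<Omega>) u"
proof -
  define D where "D = diameter \<Omega>"
  define R where "R = D / 2"
  define \<Lambda> where "\<Lambda> = 2 / D"
  have D: "D > 0" using diameter_pos by (simp add: D_def)
  have R: "R > 0" and \<Lambda>: "\<Lambda> \<ge> 0" and \<Lambda>R: "\<Lambda> * R = 1"
    using D by (auto simp: R_def \<Lambda>_def)
  obtain a b where a: "a \<in> closure \<Omega>" and b: "b \<in> closure \<Omega>" and "dist a b = diameter (closure \<Omega>)"
    using diameter_compact_attained[OF compact_closure] nonempty by auto
  then have ab: "norm (a - b) = 2 * R"
    using bounded_\<Omega> by (simp add: R_def D_def diameter_closure dist_norm)
  have le_D: "norm (x - y) \<le> 2 * R" if "x \<in> closure \<Omega>" "y \<in> closure \<Omega>" for x y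
    using dist_le_diameter[OF that] by (simp add: R_def D_def)
  have frontierI: "x \<in> frontier \<Omega>" if "x \<in> closure \<Omega>" "y \<in> closure \<Omega>" "2 * R \<le> norm (x - y)" for x y
    using diametral_in_frontier[OF that(1,2)] that(3) by (simp add: R_def D_def)
  \<comment> \<open>The two bounds force the value \<open>R\<close> at \<open>a\<close>. Together
    with the value \<open>- R\<close> at \<open>b\<close> this keeps the supremum
    nonconstant.\<close>
  define P where "P = {v. continuous_on (closure \<Omega>) v \<and>
    (\<forall>x\<in>closure \<Omega>. R - norm (x - a) \<le> v x \<and> v x \<le> R) \<and> v b = - R \<and>
    (\<forall>x\<in>closure \<Omega>. x \<noteq> a \<longrightarrow> x \<noteq> b \<longrightarrow> sub_at \<Lambda> v x)}"
  have lip_P: "v x \<le> v z + norm (x - z)" if v: "v \<in> P" and x: "x \<in> closure \<Omega>" and z: "z \<in> closure \<Omega>" for v x z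
  proof -
    have cv: "continuous_on (closure \<Omega>) v"
      and bd: "\<And>x. x \<in> closure \<Omega> \<Longrightarrow> R - norm (x - a) \<le> v x" "\<And>x. x \<in> closure \<Omega> \<Longrightarrow> v x \<le> R"
      and vb: "v b = - R"
      and sub: "\<And>x. x \<in> closure \<Omega> \<Longrightarrow> x \<noteq> a \<Longrightarrow> x \<noteq> b \<Longrightarrow> sub_at \<Lambda> v x"
      using v unfolding P_def by auto
    have "v x \<le> v z + 1 * norm (x - z)"
    proof (rule le_on_closure[OF cv _ z])
      fix z assume z: "z \<in> \<Omega>"
      then have zc: "z \<in> closure \<Omega>" using closure_subset by blast
      \<comment> \<open>At \<open>a\<close> the estimate is the lower bound for \<open>v z\<close>;
        at \<open>b\<close> it holds because \<open>- R\<close> is the least possible value, all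
        distances from \<open>a\<close> being at most \<open>2 * R\<close>.\<close>
      have "v y \<le> v z + \<Lambda> * R * norm (y - z)"
        if y: "y \<in> closure \<Omega>" "\<not> sub_at \<Lambda> v y" for y
      proof -
        consider "y = a" | "y = b" using sub y by blast
        then show ?thesis
        proof cases
          case 1
          then show ?thesis using bd(2)[OF a] bd(1)[OF zc] \<Lambda>R by (simp add: norm_minus_commute)
        next
          case 2
          have "- R \<le> v z" using bd(1)[OF zc] le_D[OF zc a] by linarith
          then show ?thesis using 2 vb \<Lambda>R by (simp add: add_increasing2)
        qed
      qed
      then show "v x \<le> v z + 1 * norm (x - z)"
        using sub_cone_comparison_interior[OF cv \<Lambda> less_imp_le[OF R] bd(2) z _ x] \<Lambda>R by fastforce
    qed
    then show ?thesis by simp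
  qed
  \<comment> \<open>The downward cone at \<open>a\<close> makes the family nonempty. It has slope 1
    and zero second derivative along its rays, and its absolute value is at most \<open>R\<close>,
    so the operator is nonpositive away from \<open>a\<close>.\<close>
  have v0: "(\<lambda>x. R - norm (x - a)) \<in> P"
  proof -
    have "sub_at \<Lambda> (\<lambda>x. R - norm (x - a)) x" if x: "x \<in> closure \<Omega>" "x \<noteq> a" for x
    proof -
      define t where "t = norm (x - a)"
      have t: "t > 0" "t \<le> 2 * R" using x le_D[OF x(1) a] by (auto simp: t_def)
      have xa: "(x - a) \<bullet> (x - a) = t\<^sup>2" by (simp add: t_def power2_norm_eq_inner)
      have "C2_on (- {a}) (\<lambda>x. R + 0 \<bullet> (x - a)) (\<lambda>x. 0) (\<lambda>x h. 0)"
        using C2_on_subset[OF C2_on_affine] by blast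
      note C = C2_on_add[OF this C2_on_cone[of a "-1" 0]]
      define p where "p = 0 + ((- 1) / t - 2 * 0) *\<^sub>R (x - a)"
      have p: "p = (- 1 / t) *\<^sub>R (x - a)" by (simp add: p_def)
      have np: "norm p = 1" using t by (simp add: p t_def)
      show ?thesis
      proof (rule sub_at_classical[OF C _ x(1), folded t_def, folded p_def])
        have e: "p \<bullet> p = 1" "(x - a) \<bullet> p = - t"
          using np t by (simp add: dot_square_norm) (use t in \<open>simp add: p xa power2_eq_square\<close>)
        have "(0 + ((- 1 / t - 2 * 0) *\<^sub>R p - (- 1 / t ^ 3 * ((x - a) \<bullet> p)) *\<^sub>R (x - a))) \<bullet> p
          = (- 1 / t) * (p \<bullet> p) + 1 / t ^ 3 * ((x - a) \<bullet> p) * ((x - a) \<bullet> p)"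
          unfolding add_0 inner_diff_left[of "_ *\<^sub>R p"] inner_scaleR_left by simp
        also have "\<dots> = (- 1 / t) * 1 + 1 / t ^ 3 * (- t) * (- t)"
          unfolding e ..
        also have "\<dots> = 0"
          using t by (simp add: field_simps power3_eq_cube)
        finally have q: "(0 + ((- 1 / t - 2 * 0) *\<^sub>R p - (- 1 / t ^ 3 * ((x - a) \<bullet> p)) *\<^sub>R (x - a))) \<bullet> p = 0" .
        have "\<Lambda> * \<bar>R - t\<bar> \<le> \<Lambda> * R" using t \<Lambda> by (intro mult_left_mono) auto
        then show "E_op \<Lambda> (R - norm (x - a)) p ((0 + ((- 1 / t - 2 * 0) *\<^sub>R p
            - (- 1 / t ^ 3 * ((x - a) \<bullet> p)) *\<^sub>R (x - a))) \<bullet> p) \<le> 0"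
          unfolding q E_op_def np \<Lambda>R t_def[symmetric] by auto
        show "p \<bullet> grad \<rho> x \<le> 0" if fr: "x \<in> frontier \<Omega>"
        proof -
          \<comment> \<open>Since \<open>a\<close> is only in the closure,
            \<open>grad_inward\<close> is used for interior points and passed to the limit, losing
            strictness.\<close>
          have "0 \<le> grad \<rho> x \<bullet> (x - a)"
            by (rule continuous_ge_on_closure[of \<Omega> "\<lambda>z. grad \<rho> x \<bullet> (x - z)" a 0])
              (use a grad_inward[OF fr] in \<open>auto intro!: continuous_intros less_imp_le\<close>)
          then show ?thesis using t by (simp add: p inner_commute divide_nonneg_pos)
        qed
      qed (use x in \<open>auto simp: t_def\<close>)
    qed
    then show ?thesis
      using R ab by (auto simp: P_def norm_minus_commute intro!: continuous_intros)
  qed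
  define u where "u x = (SUP v\<in>P. v x)" for x
  have bdd: "bdd_above ((\<lambda>v. v x) ` P)" if "x \<in> closure \<Omega>" for x
    using that by (intro bdd_aboveI[of _ R]) (auto simp: P_def)
  have upper: "v x \<le> u x" if "v \<in> P" "x \<in> closure \<Omega>" for v x
    unfolding u_def using cSUP_upper[OF that(1) bdd[OF that(2)]] .
  have ne: "P \<noteq> {}" using v0 by blast
  have least: "u x \<le> c" if "\<And>v. v \<in> P \<Longrightarrow> v x \<le> c" for x c
    unfolding u_def using cSUP_least[OF ne that] .
  have lip: "u x \<le> u z + norm (x - z)" if "x \<in> closure \<Omega>" "z \<in> closure \<Omega>" for x z
  proof (rule least)
    fix v assume "v \<in> P"
    then show "v x \<le> u z + norm (x - z)" using lip_P[OF _ that] upper[OF _ that(2)] by fastforce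
  qed
  have L: "1-lipschitz_on (closure \<Omega>) u"
  proof (rule lipschitz_onI)
    show "dist (u x) (u z) \<le> 1 * dist x z" if "x \<in> closure \<Omega>" "z \<in> closure \<Omega>" for x z
      using lip[OF that] lip[OF that(2,1)] by (simp add: dist_norm norm_minus_commute abs_le_iff)
  qed simp
  then have cu: "continuous_on (closure \<Omega>) u" by (rule lipschitz_on_continuous_on)
  have u_le: "u x \<le> R" if "x \<in> closure \<Omega>" for x using least that by (auto simp: P_def)
  have u_ge: "R - norm (x - a) \<le> u x" if "x \<in> closure \<Omega>" for x using upper[OF v0 that] .
  have ub: "u b = - R"
  proof (rule antisym)
    show "u b \<le> - R" by (rule least) (simp add: P_def)
    show "- R \<le> u b" using u_ge[OF b] ab by (simp add: norm_minus_commute)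
  qed
  have ua: "u a = R" using u_le[OF a] u_ge[OF a] by simp
  have u_sub: "sub_at \<Lambda> u y" if y: "y \<in> closure \<Omega>" "y \<noteq> a" "y \<noteq> b" for y
  proof (rule sub_at_Sup[OF \<Lambda> y(1) cu, of P "- {a, b}"])
    show "\<exists>v\<in>P. u y - \<delta> < v y" if "\<delta> > 0" for \<delta>
    proof (rule ccontr)
      assume "\<not> (\<exists>v\<in>P. u y - \<delta> < v y)"
      then have "u y \<le> u y - \<delta>" by (intro least) force
      then show False using that by simp
    qed
  qed (use y upper in \<open>auto simp: P_def\<close>)
  have uP: "u \<in> P" using cu u_ge u_le ub u_sub by (auto simp: P_def)
  have u_min: "- R \<le> u x" if "x \<in> closure \<Omega>" for x
    using u_ge[OF that] le_D[OF that a] by linarith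
  have sub: "sub_at \<Lambda> u x" if x: "x \<in> closure \<Omega>" for x
  proof -
    have "sub_at \<Lambda> u a"
      using frontierI[OF a b] ab ua R \<Lambda>R u_ge by (intro sub_at_boundary_peak) auto
    moreover have "sub_at \<Lambda> u b"
      using frontierI[OF b a] ab ub u_min by (intro sub_at_boundary_min) (auto simp: norm_minus_commute)
    ultimately show ?thesis using u_sub x by blast
  qed
  have super: "sub_at \<Lambda> (\<lambda>x. - u x) x" if x: "x \<in> closure \<Omega>" for x
  proof -
    \<comment> \<open>A bump must keep the value at \<open>b\<close> and the bound \<open>R\<close>,
      so it is available only in the third case. In the first, the Lipschitz bound puts
      \<open>x\<close> at distance \<open>2 * R\<close> from \<open>b\<close>, hence on the
      boundary.\<close>
    consider "u x = R" | "x = b" | "u x < R" "x \<noteq> a" "x \<noteq> b"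
      using u_le[OF x] ua by fastforce
    then show ?thesis
    proof cases
      case 1
      then have "x \<in> frontier \<Omega>" using lip[OF x b] ub frontierI[OF x b] by simp
      then show ?thesis using 1 u_le by (intro sub_at_boundary_min) auto
    next
      case 2
      have "b \<in> frontier \<Omega>" using frontierI[OF b a] ab by (simp add: norm_minus_commute)
      moreover have "- u b - norm (y - b) \<le> - u y" if "y \<in> closure \<Omega>" for y
        using lip[OF that b] by simp
      ultimately show ?thesis unfolding 2 using ub R \<Lambda>R by (intro sub_at_boundary_peak) auto
    next
      case 3
      show ?thesis
      proof (rule ccontr)
        assume not: "\<not> sub_at \<Lambda> (\<lambda>x. - u x) x"
        have oN: "open (- {a, b})" by (intro open_Compl finite_imp_closed) simp
        have xN: "x \<in> - {a, b}" and pos: "R - u x > 0" using 3 by auto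
        \<comment> \<open>The height \<open>R - u x\<close> keeps \<open>w\<close> below
          \<open>R\<close>, and avoiding \<open>a\<close> and \<open>b\<close> preserves the
          prescribed values. Thus \<open>w\<close> belongs to \<open>P\<close> and exceeds the
          supremum at \<open>x\<close>.\<close>
        obtain w where w: "continuous_on (closure \<Omega>) w" "u x < w x" "\<And>y. u y \<le> w y"
          "\<And>y. y \<in> closure \<Omega> \<Longrightarrow> w y \<noteq> u y \<Longrightarrow> y \<in> - {a, b} \<and> w y \<le> u x + (R - u x)"
          "\<And>y. y \<in> closure \<Omega> \<Longrightarrow> w y \<noteq> u y \<or> sub_at \<Lambda> u y \<Longrightarrow> sub_at \<Lambda> w y"
          using subsolution_bump[OF \<Lambda> x cu not oN xN pos] by metis
        have "w b = - R" using w(4)[OF b] ub by auto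
        moreover have "R - norm (y - a) \<le> w y \<and> w y \<le> R" if "y \<in> closure \<Omega>" for y
          using w(3)[of y] w(4)[OF that] u_ge[OF that] u_le[OF that] by force
        ultimately have "w \<in> P" using w(1,5) sub by (simp add: P_def)
        then show False using upper[OF _ x] w(2) by fastforce
      qed
    qed
  qed
  have "visc_solution \<Omega> (outer_normal \<rho>) \<Lambda> u"
    unfolding visc_solution_def visc_super_iff
    using cu sub super visc_sub_iff[OF cu] visc_sub_iff[OF continuous_on_minus[OF cu]] by blast
  moreover have "nonconstant_on (closure \<Omega>) u"
    unfolding nonconstant_on_def using a b ua ub R by (intro bexI[of _ a] bexI[of _ b]) auto
  ultimately show ?thesis using L unfolding \<Lambda>_def D_def by blast
qed

end

theorem theorem1:
  fixes \<Omega> :: "'a::euclidean_space set" and \<rho> :: "'a \<Rightarrow> real"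
  assumes "open \<Omega>" and "bounded \<Omega>" and "convex \<Omega>" and "\<Omega> \<noteq> {}"
    and "smooth_defining_fun \<Omega> \<rho>"
  shows "(\<forall>\<Lambda> u. \<Lambda> \<ge> 0 \<and> visc_solution \<Omega> (outer_normal \<rho>) \<Lambda> u \<and> nonconstant_on (closure \<Omega>) u
            \<longrightarrow> \<Lambda> \<ge> 2 / diameter \<Omega>)
       \<and> (\<exists>u (L::real). visc_solution \<Omega> (outer_normal \<rho>) (2 / diameter \<Omega>) u
            \<and> nonconstant_on (closure \<Omega>) u \<and> lipschitz_on L (closure \<Omega>) u)"
proof -
  interpret smooth_convex_domain \<Omega> \<rho>
    using assms by unfold_locales
  show ?thesis
    using eigenvalue_lower_bound critical_solution_exists diameter_pos
    by (simp add: divide_le_eq) blast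
qed

end
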